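(* Suppose there exist functions $\alpha:\mathbb{R}^{2m}\to\mathbb{R}$ and $\rho:\mathbb{R}^{2m}\times(0,\infty)\to\mathbb{R}$ such that $\Delta(x,h)=h^2\alpha(x)+h^2\rho(x,h)$ with $\lim_{h\to0}\rho(x,h)=0$ for every $x$, and suppose there exists $D:\mathbb{R}^{2m}\to\mathbb{R}$ such that $$\sup_{0<h\le1}\frac{|\Delta(x,h)|^2}{h^4}\le D(x),\qquad \int_{\mathbb{R}^{2m}}D(x)\,e^{-H(x)}\,dx<\infty .$$ Let $\Sigma=\int\alpha^2\,d\pi$, assumed positive. For $l>0$ let $h=l\cdot d^{-1/4}$, let $a(l):=\lim_{d\to\infty}\mathbb{E}[a(X,Y)]=2\Phi(-l^2\sqrt\Sigma/2)$ (limit in stationarity), and let $\mathsf{E}^*_{l,d}:=\mathsf{C}_{l,d}/\mathbb{E}[a(X,Y)]$. Then, as $d\to\infty$, the cost $\mathsf{E}^*_{l,d}$ is minimised, in the sense that the asymptotic cost $l\mapsto\lim_{d\to\infty}d^{-5/4}\,\mathsf{E}^*_{l,d}$ is minimised over $l>0$, for the choice $l_{opt}$ of $l$ that leads to the value $a=a(l)\in(0,1)$ that maximises $$\mathrm{eff}(a)=\Bigl(\frac{\sqrt2}{\Sigma^{1/4}}\Bigr)\cdot a\cdot\Bigl(\Phi^{-1}\bigl(1-\tfrac a2\bigr)\Bigr)^{1/2}.$$ Rounded to 3 decimal places, the optimal value of the limit probability, which is independent of the target, is $a(l_{opt})=0.651$.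
   Context: Fix an integer $m\ge1$, a symmetric positive definite $m\times m$ matrix $M$, a time $T>0$ and a differentiable $V:\mathbb{R}^m\to\mathbb{R}$ with $\int e^{-V}<\infty$. For $x=(q,p)\in\mathbb{R}^{2m}$ put $H(q,p)=\frac12\langle p,M^{-1}p\rangle+V(q)$, and let $\pi$ be the probability measure on $\mathbb{R}^{2m}$ with density proportional to $e^{-H}$. The leapfrog map with step $h>0$ is $\psi_h(q,p)=(q',p')$ with $$p_{1/2}=p-\tfrac h2\nabla V(q),\quad q'=q+hM^{-1}p_{1/2},\quad p'=p_{1/2}-\tfrac h2\nabla V(q'),$$ and $\psi_h^{(T)}:=\psi_h^{\lfloor T/h\rfloor}$ (composition power). The energy error is $\Delta(x,h):=H(\psi_h^{(T)}(x))-H(x)$. Hybrid Monte Carlo with $d$ particles: the state is $X=(x_1,\dots,x_d)\in(\mathbb{R}^{2m})^d$; the proposal is $Y=(\psi_h^{(T)}(x_1),\dots,\psi_h^{(T)}(x_d))$; the acceptance probability is $a(X,Y)=1\wedge\exp\bigl(\sum_{i=1}^d[H(x_i)-H(\psi_h^{(T)}(x_i))]\bigr)$. "In stationarity" means $X\sim\pi^{\otimes d}$. The computing time of one proposal is $$\mathsf{C}_{l,d}:=\Bigl\lceil\frac{T\,d^{1/4}}{l}\Bigr\rceil\cdot d\cdot C_{LF}+d\cdot C_O,$$ where $C_{LF}>0$ and $C_O\ge0$ are constants (leapfrog cost and overheads per particle). $\Phi$ is the standard normal distribution function and $\Phi^{-1}$ its inverse. *)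

theory Defs
  imports "HOL-Probability.Probability"
begin

type_synonym 'm phase = "(real ^ 'm) \<times> (real ^ 'm)"

definition symmetric_pos_def :: "real ^ 'm ^ 'm \<Rightarrow> bool" where
  "symmetric_pos_def M \<longleftrightarrow> transpose M = M \<and> (\<forall>v. v \<noteq> 0 \<longrightarrow> 0 < v \<bullet> (M *v v))"

text \<open>The gradient vector; meaningful only where \<open>f\<close> is differentiable.\<close>

definition grad :: "(real ^ 'm \<Rightarrow> real) \<Rightarrow> real ^ 'm \<Rightarrow> real ^ 'm" where
  "grad f x = (THE g. GDERIV f x :> g)"

definition hamiltonian :: "real ^ 'm ^ 'm \<Rightarrow> (real ^ 'm \<Rightarrow> real) \<Rightarrow> 'm phase \<Rightarrow> real" where
  "hamiltonian M V = (\<lambda>(q, p). (p \<bullet> (matrix_inv M *v p)) / 2 + V q)"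

definition target :: "real ^ 'm ^ 'm \<Rightarrow> (real ^ 'm \<Rightarrow> real) \<Rightarrow> 'm phase measure" where
  "target M V = density lborel
     (\<lambda>x. ennreal (exp (- hamiltonian M V x) / (LINT y|lborel. exp (- hamiltonian M V y))))"

definition leapfrog ::
    "real ^ 'm ^ 'm \<Rightarrow> (real ^ 'm \<Rightarrow> real) \<Rightarrow> real \<Rightarrow> 'm phase \<Rightarrow> 'm phase" where
  "leapfrog M V h = (\<lambda>(q, p).
     let p_half = p - (h / 2) *\<^sub>R grad V q;
         q' = q + h *\<^sub>R (matrix_inv M *v p_half);
         p' = p_half - (h / 2) *\<^sub>R grad V q'
     in (q', p'))"

definition leapfrog_flow ::
    "real ^ 'm ^ 'm \<Rightarrow> (real ^ 'm \<Rightarrow> real) \<Rightarrow> real \<Rightarrow> real \<Rightarrow> 'm phase \<Rightarrow> 'm phase" where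
  "leapfrog_flow M V T h = leapfrog M V h ^^ nat \<lfloor>T / h\<rfloor>"

definition energy_error ::
    "real ^ 'm ^ 'm \<Rightarrow> (real ^ 'm \<Rightarrow> real) \<Rightarrow> real \<Rightarrow> 'm phase \<Rightarrow> real \<Rightarrow> real" where
  "energy_error M V T x h = hamiltonian M V (leapfrog_flow M V T h x) - hamiltonian M V x"

text \<open>A state of the \<open>d\<close>-particle chain is a function on the index set \<open>{..<d}\<close>.\<close>

definition proposal ::
    "real ^ 'm ^ 'm \<Rightarrow> (real ^ 'm \<Rightarrow> real) \<Rightarrow> real \<Rightarrow> real \<Rightarrow> nat \<Rightarrow> (nat \<Rightarrow> 'm phase) \<Rightarrow> (nat \<Rightarrow> 'm phase)" where
  "proposal M V T h d X = (\<lambda>i\<in>{..<d}. leapfrog_flow M V T h (X i))"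

definition acceptance ::
    "real ^ 'm ^ 'm \<Rightarrow> (real ^ 'm \<Rightarrow> real) \<Rightarrow> nat \<Rightarrow> (nat \<Rightarrow> 'm phase) \<Rightarrow> (nat \<Rightarrow> 'm phase) \<Rightarrow> real" where
  "acceptance M V d X Y = min 1 (exp (\<Sum>i<d. hamiltonian M V (X i) - hamiltonian M V (Y i)))"

text \<open>The expectation of \<open>a(X,Y)\<close> in stationarity, with step size \<open>h = l d\<^sup>-\<^sup>1\<^sup>/\<^sup>4\<close>.\<close>

definition mean_acceptance ::
    "real ^ 'm ^ 'm \<Rightarrow> (real ^ 'm \<Rightarrow> real) \<Rightarrow> real \<Rightarrow> real \<Rightarrow> nat \<Rightarrow> real" where
  "mean_acceptance M V T l d =
     (LINT X|(\<Pi>\<^sub>M i\<in>{..<d}. target M V).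
        acceptance M V d X (proposal M V T (l * real d powr (-1/4)) d X))"

definition limit_acceptance ::
    "real ^ 'm ^ 'm \<Rightarrow> (real ^ 'm \<Rightarrow> real) \<Rightarrow> real \<Rightarrow> real \<Rightarrow> real" where
  "limit_acceptance M V T l = lim (\<lambda>d. mean_acceptance M V T l d)"

definition proposal_cost :: "real \<Rightarrow> real \<Rightarrow> real \<Rightarrow> real \<Rightarrow> nat \<Rightarrow> real" where
  "proposal_cost T C_LF C_O l d =
     of_int \<lceil>T * real d powr (1/4) / l\<rceil> * real d * C_LF + real d * C_O"

definition expected_cost ::
    "real ^ 'm ^ 'm \<Rightarrow> (real ^ 'm \<Rightarrow> real) \<Rightarrow> real \<Rightarrow> real \<Rightarrow> real \<Rightarrow> real \<Rightarrow> nat \<Rightarrow> real" where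
  "expected_cost M V T C_LF C_O l d = proposal_cost T C_LF C_O l d / mean_acceptance M V T l d"

definition asymptotic_cost ::
    "real ^ 'm ^ 'm \<Rightarrow> (real ^ 'm \<Rightarrow> real) \<Rightarrow> real \<Rightarrow> real \<Rightarrow> real \<Rightarrow> real \<Rightarrow> real" where
  "asymptotic_cost M V T C_LF C_O l =
     lim (\<lambda>d. real d powr (-5/4) * expected_cost M V T C_LF C_O l d)"

definition Phi :: "real \<Rightarrow> real" where
  "Phi = cdf std_normal_distribution"

text \<open>\<open>Phi\<close> is injective with range \<open>{0<..<1}\<close>, so \<open>inv Phi\<close> is the quantile function there;
  for \<open>a \<in> {0<..<1}\<close> its argument \<open>1 - a/2\<close> lies in \<open>{1/2<..<1}\<close> and its value is positive.\<close>

definition eff :: "real \<Rightarrow> real \<Rightarrow> real" where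
  "eff S a = (sqrt 2 / S powr (1/4)) * a * sqrt (inv Phi (1 - a / 2))"

end

theory Submission
  imports Defs
begin

text \<open>
  Each leapfrog step is a composition of shears, hence preserves Lebesgue measure, and composing the
  flow with the momentum flip gives a measure-preserving map that changes the sign of the energy
  error \<open>\<Delta>\<close>. Hence \<open>E f(\<Delta>) = E (f(-\<Delta>) exp(-\<Delta>))\<close>, and a suitable choice of \<open>f\<close> yields
  \<open>E sin(t \<Delta>) = E (sin(t \<Delta>) tanh(\<Delta>/2))\<close>. Both \<open>cos(t \<Delta>) - 1\<close> and \<open>sin(t \<Delta>) tanh(\<Delta>/2)\<close> are
  \<open>O(\<Delta>\<^sup>2)\<close>, so dominated convergence gives \<open>d (E exp(i t \<Delta>) - 1) \<rightarrow> l\<^sup>4 \<Sigma> (i t - t\<^sup>2)/2\<close>. By Levy's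
  continuity theorem the total energy error converges to \<open>N(s\<^sup>2/2, s\<^sup>2)\<close> with \<open>s = l\<^sup>2 sqrt \<Sigma>\<close>,
  and the mean acceptance to \<open>2 Phi(-s/2)\<close>.

  With \<open>y = s/2\<close> the asymptotic cost is a constant divided by \<open>sqrt y (1 - Phi y)\<close>, and \<open>eff\<close> at
  \<open>a = 2 (1 - Phi y)\<close> is a constant multiple of the same function. Its unique critical point is the
  zero of \<open>1 - Phi y - 2 y Phi'(y)\<close>, which is located by Taylor bounds.
\<close>

section \<open>The standard normal distribution\<close>

lemma Phi_eq_integral:
  "Phi x = (LINT t|lborel. indicator {..x} t * std_normal_density t)"
proof -
  interpret real_distribution std_normal_distribution by (rule real_dist_normal_dist)
  have "Phi x = (LINT t|std_normal_distribution. indicator {..x} t)"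
    unfolding Phi_def cdf_def by simp
  also have "\<dots> = (LINT t|lborel. std_normal_density t *\<^sub>R indicator {..x} t)"
    by (subst integral_density) auto
  finally show ?thesis by (simp add: mult.commute)
qed

lemma integrable_indicator_std_normal [simp]:
  "A \<in> sets borel \<Longrightarrow> integrable lborel (\<lambda>t. indicator A t * std_normal_density t)"
  using integrable_mult_indicator[of A lborel std_normal_density] by simp

lemma Phi_diff:
  assumes "a \<le> b"
  shows "Phi b - Phi a = integral {a..b} std_normal_density"
proof -
  have "Phi b - Phi a = (LINT t|lborel. indicator {..b} t * std_normal_density t - indicator {..a} t * std_normal_density t)"
    unfolding Phi_eq_integral by (subst Bochner_Integration.integral_diff) auto
  also have "\<dots> = (LINT t|lborel. indicator {a<..b} t * std_normal_density t)"
    using assms by (intro Bochner_Integration.integral_cong) (auto simp: indicator_def)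
  also have "\<dots> = (LINT t:{a..b}|lborel. std_normal_density t)"
    unfolding set_lebesgue_integral_def
    using AE_lborel_singleton[of a]
    by (intro integral_cong_AE) (auto elim!: eventually_mono simp: indicator_def)
  also have "\<dots> = integral {a..b} std_normal_density"
    by (intro set_borel_integral_eq_integral) (simp add: set_integrable_def)
  finally show ?thesis .
qed

lemma DERIV_Phi: "(Phi has_real_derivative std_normal_density x) (at x)"
proof -
  have c: "continuous_on {x - 1..x + 1} std_normal_density"
    unfolding std_normal_density_def by (intro continuous_intros) auto
  have "((\<lambda>u. integral {x - 1..u} std_normal_density) has_real_derivative std_normal_density x) (at x within {x - 1..x + 1})"
    by (rule integral_has_real_derivative[OF c]) auto
  then have "((\<lambda>u. integral {x - 1..u} std_normal_density) has_real_derivative std_normal_density x) (at x)"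
    by (subst (asm) at_within_Icc_at) auto
  then have "((\<lambda>u. Phi (x - 1) + integral {x - 1..u} std_normal_density) has_real_derivative std_normal_density x) (at x)"
    by (auto intro!: derivative_eq_intros)
  moreover have "Phi (x - 1) + integral {x - 1..u} std_normal_density = Phi u" if "x - 1 < u" for u
    using Phi_diff[of "x - 1" u] that by simp
  ultimately show ?thesis
    by (subst DERIV_cong_ev[OF refl _ refl, of _ "\<lambda>u. Phi (x - 1) + integral {x - 1..u} std_normal_density"])
       (auto simp: eventually_nhds intro!: exI[of _ "{x - 1<..}"])
qed

lemma Phi_strict_mono: "strict_mono Phi"
proof (rule strict_monoI)
  fix x y :: real assume "x < y"
  then show "Phi x < Phi y"
    by (rule DERIV_pos_imp_increasing) (use DERIV_Phi normal_density_pos in force)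
qed

lemma isCont_Phi: "isCont Phi x"
  using DERIV_Phi DERIV_isCont by blast

lemma Phi_at_top: "(Phi \<longlongrightarrow> 1) at_top" and Phi_at_bot: "(Phi \<longlongrightarrow> 0) at_bot"
proof -
  interpret real_distribution std_normal_distribution by (rule real_dist_normal_dist)
  show "(Phi \<longlongrightarrow> 1) at_top" "(Phi \<longlongrightarrow> 0) at_bot"
    unfolding Phi_def by (rule cdf_lim_at_top_prob cdf_lim_at_bot)+
qed

lemma Phi_minus: "Phi (- x) = 1 - Phi x"
proof -
  have "Phi (- x) = (LINT t|lborel. indicator {..-x} (0 + (-1) * t) * std_normal_density (0 + (-1) * t))"
    unfolding Phi_eq_integral
    by (subst lborel_integral_real_affine[where c="-1" and t=0]) auto
  also have "\<dots> = (LINT t|lborel. std_normal_density t - indicator {..x} t * std_normal_density t)"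
    \<comment> \<open>After the reflection the two integrands disagree only at the single point t =
      x.\<close>
    using AE_lborel_singleton[of x]
    by (intro integral_cong_AE)
       (auto elim!: eventually_mono simp: indicator_def std_normal_density_def)
  also have "\<dots> = 1 - Phi x"
    unfolding Phi_eq_integral by (subst Bochner_Integration.integral_diff) auto
  finally show ?thesis .
qed

lemma Phi_0: "Phi 0 = 1/2"
  using Phi_minus[of 0] by simp

lemma Phi_less_1: "Phi x < 1"
proof -
  have "Phi (x + 1) \<le> 1"
    unfolding Phi_def by (rule real_distribution.cdf_bounded_prob[OF real_dist_normal_dist])
  moreover have "Phi x < Phi (x + 1)"
    by (rule strict_monoD[OF Phi_strict_mono]) simp
  ultimately show ?thesis by linarith
qed

lemma range_Phi: assumes "0 < a" "a < 1" shows "a \<in> range Phi"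
proof -
  have "eventually (\<lambda>x. Phi x < a) at_bot" "eventually (\<lambda>x. a < Phi x) at_top"
    using order_tendstoD[OF Phi_at_bot] order_tendstoD[OF Phi_at_top] assms by auto
  then obtain x y where "Phi x < a" "a < Phi y"
    unfolding eventually_at_bot_linorder eventually_at_top_linorder by blast
  moreover from this have "x < y"
    using strict_mono_less[OF Phi_strict_mono, of x y] by simp
  ultimately have "\<exists>z\<ge>x. z \<le> y \<and> Phi z = a"
    using IVT[of Phi x a y] isCont_Phi by fastforce
  then show ?thesis by auto
qed

section \<open>Taylor bounds for exp, \<open>Phi\<close> and arctan, and an enclosure of pi\<close>

lemma exp_minus_lower:
  fixes u :: real
  assumes "0 \<le> u"
  shows "1 - u + u\<^sup>2/2 - u^3/6 \<le> exp (- u)"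
proof -
  obtain t where "exp (- u) = (\<Sum>m<4. (- u)^m / fact m) + exp t / fact 4 * (- u)^4"
    using Maclaurin_exp_le[of "-u" 4] by auto
  moreover have "0 \<le> exp t / fact 4 * (- u)^4" by simp
  ultimately show ?thesis by (simp add: eval_nat_numeral)
qed

lemma exp_minus_upper:
  fixes u :: real
  assumes "0 \<le> u"
  shows "exp (- u) \<le> 1 - u + u\<^sup>2/2"
proof -
  obtain t where "exp (- u) = (\<Sum>m<3. (- u)^m / fact m) + exp t / fact 3 * (- u)^3"
    using Maclaurin_exp_le[of "-u" 3] by auto
  moreover have "exp t / fact 3 * (- u)^3 \<le> 0" using assms by simp
  ultimately show ?thesis by (simp add: eval_nat_numeral)
qed

text \<open>The alternating bounds for exp(-u) at u = x^2/2 are integrated from 0 to y: the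
  difference of the two sides vanishes at 0 and has a nonnegative derivative.\<close>

lemma Phi_bounds:
  assumes "0 \<le> y"
  shows "y - y^3/6 + y^5/40 - y^7/336 \<le> (Phi y - 1/2) * sqrt (2 * pi)"
    and "(Phi y - 1/2) * sqrt (2 * pi) \<le> y - y^3/6 + y^5/40"
proof -
  let ?s = "sqrt (2 * pi)"
  have d: "((\<lambda>y. (Phi y - 1/2) * ?s) has_real_derivative exp (- (x\<^sup>2/2))) (at x)" for x
    by (auto intro!: derivative_eq_intros DERIV_Phi simp: std_normal_density_def field_simps)
  have "(\<lambda>y. (Phi y - 1/2) * ?s - (y - y^3/6 + y^5/40 - y^7/336)) 0
      \<le> (\<lambda>y. (Phi y - 1/2) * ?s - (y - y^3/6 + y^5/40 - y^7/336)) y"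
  proof (rule DERIV_nonneg_imp_nondecreasing[OF assms])
    fix x :: real
    have "((\<lambda>y. (Phi y - 1/2) * ?s - (y - y^3/6 + y^5/40 - y^7/336)) has_real_derivative
        exp (- (x\<^sup>2/2)) - (1 - x\<^sup>2/2 + (x\<^sup>2/2)\<^sup>2/2 - (x\<^sup>2/2)^3/6)) (at x)"
      by (rule DERIV_diff[OF d]) (auto intro!: derivative_eq_intros simp: field_simps eval_nat_numeral)
    then show "\<exists>z. ((\<lambda>y. (Phi y - 1/2) * ?s - (y - y^3/6 + y^5/40 - y^7/336)) has_real_derivative z) (at x) \<and> 0 \<le> z"
      using exp_minus_lower[of "x\<^sup>2/2"] by (intro exI conjI) auto
  qed
  then show "y - y^3/6 + y^5/40 - y^7/336 \<le> (Phi y - 1/2) * ?s"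
    by (simp add: Phi_0)
  have "(\<lambda>y. (y - y^3/6 + y^5/40) - (Phi y - 1/2) * ?s) 0
      \<le> (\<lambda>y. (y - y^3/6 + y^5/40) - (Phi y - 1/2) * ?s) y"
  proof (rule DERIV_nonneg_imp_nondecreasing[OF assms])
    fix x :: real
    have "((\<lambda>y. (y - y^3/6 + y^5/40) - (Phi y - 1/2) * ?s) has_real_derivative
        (1 - x\<^sup>2/2 + (x\<^sup>2/2)\<^sup>2/2) - exp (- (x\<^sup>2/2))) (at x)"
      by (rule DERIV_diff[OF _ d]) (auto intro!: derivative_eq_intros simp: field_simps eval_nat_numeral)
    then show "\<exists>z. ((\<lambda>y. (y - y^3/6 + y^5/40) - (Phi y - 1/2) * ?s) has_real_derivative z) (at x) \<and> 0 \<le> z"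
      using exp_minus_upper[of "x\<^sup>2/2"] by (intro exI conjI) auto
  qed
  then show "(Phi y - 1/2) * ?s \<le> y - y^3/6 + y^5/40"
    by (simp add: Phi_0)
qed

text \<open>Same scheme as in \<open>Phi_bounds\<close>. The derivatives of the two differences are
  the remainders t^8/(1+t^2) and t^6/(1+t^2) of the geometric series for 1/(1+t^2).\<close>

lemma arctan_bounds_Taylor:
  fixes x :: real
  assumes "0 \<le> x"
  shows "x - x^3/3 + x^5/5 - x^7/7 \<le> arctan x" "arctan x \<le> x - x^3/3 + x^5/5" 
proof -
  have "(\<lambda>x. arctan x - (x - x^3/3 + x^5/5 - x^7/7)) 0 \<le> (\<lambda>x. arctan x - (x - x^3/3 + x^5/5 - x^7/7)) x"
  proof (rule DERIV_nonneg_imp_nondecreasing[OF assms])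
    fix t :: real
    have p: "0 < 1 + t\<^sup>2" by (smt (verit) zero_le_power2)
    have "((\<lambda>x. arctan x - (x - x^3/3 + x^5/5 - x^7/7)) has_real_derivative inverse (1 + t\<^sup>2) - (1 - t\<^sup>2 + t^4 - t^6)) (at t)"
      by (auto intro!: derivative_eq_intros)
    moreover have "inverse (1 + t\<^sup>2) - (1 - t\<^sup>2 + t^4 - t^6) = t^8 / (1 + t\<^sup>2)"
      using p by (simp add: field_simps eval_nat_numeral)
    ultimately show "\<exists>z. ((\<lambda>x. arctan x - (x - x^3/3 + x^5/5 - x^7/7)) has_real_derivative z) (at t) \<and> 0 \<le> z"
      using p by (intro exI conjI) (auto simp del: inverse_eq_divide)
  qed
  then show "x - x^3/3 + x^5/5 - x^7/7 \<le> arctan x" by simp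
  have "(\<lambda>x. (x - x^3/3 + x^5/5) - arctan x) 0 \<le> (\<lambda>x. (x - x^3/3 + x^5/5) - arctan x) x"
  proof (rule DERIV_nonneg_imp_nondecreasing[OF assms])
    fix t :: real
    have p: "0 < 1 + t\<^sup>2" by (smt (verit) zero_le_power2)
    have "((\<lambda>x. (x - x^3/3 + x^5/5) - arctan x) has_real_derivative (1 - t\<^sup>2 + t^4) - inverse (1 + t\<^sup>2)) (at t)"
      by (auto intro!: derivative_eq_intros)
    moreover have "(1 - t\<^sup>2 + t^4) - inverse (1 + t\<^sup>2) = t^6 / (1 + t\<^sup>2)"
      using p by (simp add: field_simps eval_nat_numeral)
    ultimately show "\<exists>z. ((\<lambda>x. (x - x^3/3 + x^5/5) - arctan x) has_real_derivative z) (at t) \<and> 0 \<le> z"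
      using p by (intro exI conjI) (auto simp del: inverse_eq_divide)
  qed
  then show "arctan x \<le> x - x^3/3 + x^5/5" by simp
qed

text \<open>Machin's formula pi/4 = 4 arctan(1/5) - arctan(1/239) pairs the lower bound at one point
  with the upper bound at the other.\<close>

lemma pi_bounds: "3.1415 < pi" "pi < 3.1417"
  using machin arctan_bounds_Taylor[of "1/5"] arctan_bounds_Taylor[of "1/239"]
  by (simp_all add: field_simps eval_nat_numeral)

section \<open>The critical point of \<open>sqrt y * (1 - Phi y)\<close>\<close>

lemma DERIV_std_normal_density:
  "(std_normal_density has_real_derivative - x * std_normal_density x) (at x)"
proof -
  have "((\<lambda>x. 1 / sqrt (2 * pi) * exp (- x\<^sup>2 / 2)) has_real_derivative
      1 / sqrt (2 * pi) * (exp (- x\<^sup>2 / 2) * (- x))) (at x)"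
    by (intro DERIV_cmult) (auto intro!: derivative_eq_intros)
  then show ?thesis unfolding std_normal_density_def[abs_def] by (simp add: mult.commute)
qed

text \<open>The derivative of \<open>sqrt y * (1 - Phi y)\<close> is \<open>crit y / (2 * sqrt y)\<close>.\<close>

definition crit :: "real \<Rightarrow> real" where
  "crit y = 1 - Phi y - 2 * y * std_normal_density y"

text \<open>The first factor is the source of the threshold y^2 = 3/2 below: on the nonnegative
  half-line \<open>crit\<close> falls up to it and rises beyond it.\<close>

lemma DERIV_crit: "(crit has_real_derivative (2 * x\<^sup>2 - 3) * std_normal_density x) (at x)"
  unfolding crit_def[abs_def]
  by (auto intro!: derivative_eq_intros DERIV_Phi DERIV_std_normal_density
      simp: algebra_simps power2_eq_square)

lemma isCont_crit: "isCont crit x"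
  using DERIV_crit by (rule DERIV_isCont)

lemma crit_decreasing:
  assumes "0 \<le> x" "x < y" "2 * y\<^sup>2 \<le> 3"
  shows "crit y < crit x"
proof (rule DERIV_neg_imp_decreasing_open[OF assms(2)])
  fix t assume "x < t" "t < y"
  then have "t\<^sup>2 < y\<^sup>2" using assms by (intro power_strict_mono) auto
  then have "(2 * t\<^sup>2 - 3) * std_normal_density t < 0"
    using assms by (intro mult_neg_pos normal_density_pos) auto
  with DERIV_crit show "\<exists>z. (crit has_real_derivative z) (at t) \<and> z < 0" by blast
qed (simp add: continuous_at_imp_continuous_on isCont_crit)

lemma crit_increasing:
  assumes "0 \<le> x" "3 \<le> 2 * x\<^sup>2" "x < y"
  shows "crit x < crit y"
proof (rule DERIV_pos_imp_increasing_open[OF assms(3)])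
  fix t assume "x < t" "t < y"
  then have "x\<^sup>2 < t\<^sup>2" using assms by (intro power_strict_mono) auto
  then have "0 < (2 * t\<^sup>2 - 3) * std_normal_density t"
    using assms by (intro mult_pos_pos normal_density_pos) auto
  with DERIV_crit show "\<exists>z. (crit has_real_derivative z) (at t) \<and> 0 < z" by blast
qed (simp add: continuous_at_imp_continuous_on isCont_crit)

text \<open>Past the threshold \<open>crit\<close> increases while being bounded above by
  \<open>1 - Phi\<close>, which tends to 0. The limit argument only gives a weak inequality, so it
  is applied at y + 1 and strict growth from y to y + 1 makes the conclusion strict.\<close>

lemma crit_neg_large:
  assumes "0 \<le> y" "3 \<le> 2 * y\<^sup>2"
  shows "crit y < 0"
proof -
  have "y\<^sup>2 \<le> (y + 1)\<^sup>2" using assms by (intro power_mono) auto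
  then have y1: "3 \<le> 2 * (y + 1)\<^sup>2" using assms by linarith
  have "crit (y + 1) \<le> 0"
  proof (rule tendsto_lowerbound)
    show "((\<lambda>z. 1 - Phi z) \<longlongrightarrow> 0) at_top"
      using tendsto_diff[OF tendsto_const Phi_at_top, of 1] by simp
    show "\<forall>\<^sub>F z in at_top. crit (y + 1) \<le> 1 - Phi z"
      using eventually_gt_at_top[of "y + 1"]
    proof eventually_elim
      case (elim z)
      then have "crit (y + 1) \<le> crit z" using crit_increasing[of "y + 1" z] assms y1 by simp
      moreover have "0 \<le> 2 * z * std_normal_density z" using elim assms by simp
      ultimately show ?case unfolding crit_def by linarith
    qed
  qed simp
  with crit_increasing[of y "y + 1"] assms show ?thesis by simp
qed

lemma sqrt_2pi_bounds: "2.50659 < sqrt (2 * pi)" "sqrt (2 * pi) < 2.50668"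
proof -
  show "2.50659 < sqrt (2 * pi)"
    by (rule real_less_rsqrt) (use pi_bounds in \<open>simp add: power_divide\<close>)
  show "sqrt (2 * pi) < 2.50668"
    by (rule real_less_lsqrt) (use pi_bounds in \<open>simp_all add: power_divide\<close>)
qed

lemma crit_times_sqrt_2pi:
  "crit y * sqrt (2 * pi) = sqrt (2 * pi) / 2 - (Phi y - 1/2) * sqrt (2 * pi) - 2 * y * exp (- (y\<^sup>2/2))"
  unfolding crit_def std_normal_density_def by (simp add: field_simps)

text \<open>The bracket \<open>[0.4518, 0.4525]\<close> for the zero of \<open>crit\<close> is narrow enough to determine
  \<open>2 * (1 - Phi z)\<close> to three decimals.\<close>

lemma crit_pos: "0 < crit 0.4518"
proof -
  have "0 < crit 0.4518 * sqrt (2 * pi)"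
    unfolding crit_times_sqrt_2pi
    using Phi_bounds(2)[of "0.4518"] exp_minus_upper[of "0.4518\<^sup>2/2"] sqrt_2pi_bounds(1)
    by (simp add: power_divide)
  then show ?thesis by (simp add: zero_less_mult_iff)
qed

lemma crit_neg: "crit 0.4525 < 0"
proof -
  have "crit 0.4525 * sqrt (2 * pi) < 0"
    unfolding crit_times_sqrt_2pi
    using Phi_bounds(1)[of "0.4525"] exp_minus_lower[of "0.4525\<^sup>2/2"] sqrt_2pi_bounds(2)
    by (simp add: power_divide)
  then show ?thesis by (simp add: mult_less_0_iff)
qed

text \<open>The intermediate value theorem supplies a zero. Since it lies below the threshold,
  strict decrease gives the signs on both sides up to the threshold, and
  \<open>crit_neg_large\<close> covers the rest of the half-line.\<close>

lemma crit_sign_change: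
  obtains z where "0.4518 \<le> z" "z \<le> 0.4525" "\<And>y. 0 < y \<Longrightarrow> y < z \<Longrightarrow> 0 < crit y"
    "\<And>y. z < y \<Longrightarrow> crit y < 0"
proof -
  have "\<exists>z\<ge>0.4518. z \<le> 0.4525 \<and> crit z = 0"
    using crit_pos crit_neg by (intro IVT2) (auto intro: DERIV_isCont DERIV_crit)
  then obtain z where z: "0.4518 \<le> z" "z \<le> 0.4525" "crit z = 0" by blast
  have "crit y < 0" if "z < y" for y
  proof (cases "2 * y\<^sup>2 \<le> 3")
    case True
    then show ?thesis using crit_decreasing[of z y] z that by simp
  qed (use crit_neg_large[of y] z that in simp)
  moreover have "0 < crit y" if "0 < y" "y < z" for y
  proof -
    have "z\<^sup>2 \<le> 0.4525\<^sup>2" using z by (intro power_mono) auto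
    then have "2 * z\<^sup>2 \<le> 3" by (simp add: power_divide)
    with crit_decreasing[of y z] z that show ?thesis by simp
  qed
  ultimately show ?thesis using that[of z] z by blast
qed

text \<open>0.6505 and 0.6515 delimit the numbers that round to 0.651; they correspond to 0.17475
  and 0.17425 for \<open>Phi z - 1/2\<close>. The values 0.4368 and 0.4377 are rational separators
  between these multiples of \<open>sqrt (2 * pi)\<close> and the Taylor polynomials at the ends of
  the bracket.\<close>

lemma acceptance_bounds:
  assumes "0.4518 \<le> z" "z \<le> 0.4525"
  shows "0.6505 < 2 * (1 - Phi z)" "2 * (1 - Phi z) < 0.6515"
proof -
  have "Phi 0.4518 \<le> Phi z" "Phi z \<le> Phi 0.4525"
    using assms Phi_strict_mono by (simp_all add: strict_mono_less_eq)
  moreover have "0.17425 * sqrt (2 * pi) < (Phi 0.4518 - 1/2) * sqrt (2 * pi)"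
  proof -
    have "0.17425 * sqrt (2 * pi) < 0.4368" using sqrt_2pi_bounds(2) by simp
    also have "0.4368 \<le> (Phi 0.4518 - 1/2) * sqrt (2 * pi)"
      by (rule order_trans[OF _ Phi_bounds(1)]) (simp_all add: power_divide)
    finally show ?thesis .
  qed
  then have "0.17425 < Phi 0.4518 - 1/2" by (rule mult_right_less_imp_less) simp
  moreover have "(Phi 0.4525 - 1/2) * sqrt (2 * pi) < 0.17475 * sqrt (2 * pi)"
  proof -
    have "(Phi 0.4525 - 1/2) * sqrt (2 * pi) \<le> 0.4377"
      by (rule order_trans[OF Phi_bounds(2)]) (simp_all add: power_divide)
    also have "0.4377 < 0.17475 * sqrt (2 * pi)" using sqrt_2pi_bounds(1) by simp
    finally show ?thesis .
  qed
  then have "Phi 0.4525 - 1/2 < 0.17475" by (rule mult_right_less_imp_less) simp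
  ultimately show "0.6505 < 2 * (1 - Phi z)" "2 * (1 - Phi z) < 0.6515" by simp_all
qed

text \<open>Strict growth before z and strict decay after it make z the only maximiser. The sign
  conditions leave out z itself, hence the derivative tests on open intervals.\<close>

lemma sqrt_mult_tail_unimodal:
  assumes z: "0 < z" "\<And>y. 0 < y \<Longrightarrow> y < z \<Longrightarrow> 0 < crit y" "\<And>y. z < y \<Longrightarrow> crit y < 0"
    and y: "0 < y" "y \<noteq> z"
  shows "sqrt y * (1 - Phi y) < sqrt z * (1 - Phi z)"
proof -
  let ?f = "\<lambda>y. sqrt y * (1 - Phi y)"
  have d: "(?f has_real_derivative crit t / (2 * sqrt t)) (at t)" if "0 < t" for t
  proof -
    have "(?f has_real_derivative (inverse (sqrt t) / 2) * (1 - Phi t) + sqrt t * (- std_normal_density t)) (at t)"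
      using that by (auto intro!: derivative_eq_intros DERIV_Phi)
    moreover have "(inverse (sqrt t) / 2) * (1 - Phi t) + sqrt t * (- std_normal_density t) = crit t / (2 * sqrt t)"
      using that real_sqrt_mult_self[of t] by (simp add: crit_def field_simps)
    ultimately show ?thesis by simp
  qed
  have c: "continuous_on {a..b} ?f" if "0 < a" for a b
    using that by (intro DERIV_continuous_on[where D="\<lambda>t. crit t / (2 * sqrt t)"])
      (auto intro!: has_field_derivative_at_within d)
  show ?thesis
  proof (cases "y < z")
    case True
    show ?thesis
    proof (rule DERIV_pos_imp_increasing_open[OF True _ c[OF y(1)]])
      fix t assume "y < t" "t < z"
      then show "\<exists>v. (?f has_real_derivative v) (at t) \<and> 0 < v"
        using d[of t] z(2)[of t] y by (intro exI[of _ "crit t / (2 * sqrt t)"]) auto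
    qed
  next
    case False
    with y have "z < y" by simp
    then show ?thesis
    proof (rule DERIV_neg_imp_decreasing_open[OF _ _ c[OF z(1)]])
      fix t assume "z < t" "t < y"
      then show "\<exists>v. (?f has_real_derivative v) (at t) \<and> v < 0"
        using d[of t] z(3)[of t] z(1) by (intro exI[of _ "crit t / (2 * sqrt t)"]) (auto simp: divide_neg_pos)
    qed
  qed
qed

section \<open>The maximiser of \<open>eff\<close>\<close>

lemma ex_tail_parametrisation:
  assumes "0 < a" "a < 1"
  obtains y where "0 < y" "a = 2 * (1 - Phi y)"
proof -
  obtain y where y: "1 - a/2 = Phi y" using range_Phi[of "1 - a/2"] assms by auto
  then have "Phi 0 < Phi y" using assms by (simp add: Phi_0)
  then have "0 < y" using strict_mono_less[OF Phi_strict_mono] by blast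
  with y that[of y] show ?thesis by (simp add: field_simps)
qed

lemma eff_tail: "eff S (2 * (1 - Phi y)) = 2 * (sqrt 2 / S powr (1/4)) * (sqrt y * (1 - Phi y))"
proof -
  have "1 - 2 * (1 - Phi y) / 2 = Phi y" by (simp add: field_simps)
  then have "inv Phi (1 - 2 * (1 - Phi y) / 2) = y"
    using inv_f_f[OF strict_mono_imp_inj_on[OF Phi_strict_mono]] by simp
  then show ?thesis unfolding eff_def by simp
qed

lemma tail_in_unit_interval: "0 < y \<Longrightarrow> 2 * (1 - Phi y) \<in> {0<..<1}"
  using Phi_less_1[of y] strict_monoD[OF Phi_strict_mono, of 0 y] by (simp add: Phi_0)

text \<open>In the tail parametrisation S enters \<open>eff\<close> only as a positive factor, so
  the maximiser does not depend on it, and its uniqueness is inherited from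
  \<open>sqrt_mult_tail_unimodal\<close>.\<close>

lemma is_arg_max_eff_iff:
  assumes "0 < S" and z: "0 < z" "\<And>y. 0 < y \<Longrightarrow> y < z \<Longrightarrow> 0 < crit y" "\<And>y. z < y \<Longrightarrow> crit y < 0"
  shows "is_arg_max (eff S) (\<lambda>a. a \<in> {0<..<1}) a \<longleftrightarrow> a = 2 * (1 - Phi z)"
proof -
  have less: "eff S b < eff S (2 * (1 - Phi z))" if b: "0 < b" "b < 1" "b \<noteq> 2 * (1 - Phi z)" for b
  proof -
    obtain y where "0 < y" "b = 2 * (1 - Phi y)" using ex_tail_parametrisation b by blast
    moreover from this b have "y \<noteq> z" by auto
    ultimately show ?thesis using sqrt_mult_tail_unimodal[OF z, of y] \<open>0 < S\<close>
      by (simp only: eff_tail) (rule mult_strict_left_mono, auto)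
  qed
  show ?thesis
    using less tail_in_unit_interval[OF z(1)] unfolding is_arg_max_def
    by (metis (no_types, lifting) greaterThanLessThan_iff less_asym less_irrefl)
qed

section \<open>Mean acceptance for a Gaussian energy error\<close>

lemma std_normal_density_shift:
  "exp (- (\<sigma> * w + \<sigma>\<^sup>2/2)) * std_normal_density w = std_normal_density (w + \<sigma>)"
  unfolding std_normal_density_def
  by (simp add: mult_exp_exp power2_sum field_simps)

text \<open>The integral splits at w = -\<sigma>/2, where the exponent changes sign. To the left the
  minimum is 1; to the right the exponential tilts the density into its translate by \<sigma>. Both
  pieces have mass Phi(-\<sigma>/2).\<close>

lemma expectation_min_1_exp_normal:
  assumes "0 < \<sigma>"
  shows "(LINT w|std_normal_distribution. min 1 (exp (- (\<sigma> * w + \<sigma>\<^sup>2/2)))) = 2 * Phi (- \<sigma> / 2)"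
proof -
  have split: "std_normal_density w *\<^sub>R min 1 (exp (- (\<sigma> * w + \<sigma>\<^sup>2/2)))
      = indicator {..-\<sigma>/2} w * std_normal_density w + indicator {-\<sigma>/2<..} w * std_normal_density (w + \<sigma>)"
    for w
  proof -
    have "\<sigma> * w + \<sigma>\<^sup>2/2 \<le> 0 \<longleftrightarrow> w \<le> - \<sigma>/2"
    proof -
      have "\<sigma> * w + \<sigma>\<^sup>2/2 = \<sigma> * (w + \<sigma>/2)" by (simp add: algebra_simps power2_eq_square)
      then have "\<sigma> * w + \<sigma>\<^sup>2/2 \<le> 0 \<longleftrightarrow> w + \<sigma>/2 \<le> 0"
        using assms by (simp add: mult_le_0_iff)
      then show ?thesis by linarith
    qed
    then show ?thesis
      using std_normal_density_shift[of \<sigma> w] by (auto simp: min_def indicator_def not_le mult.commute)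
  qed
  have shift: "(LINT w|lborel. indicator {-\<sigma>/2<..} w * std_normal_density (w + \<sigma>)) = 1 - Phi (\<sigma>/2)"
  proof -
    have "(LINT w|lborel. indicator {-\<sigma>/2<..} w * std_normal_density (w + \<sigma>))
        = (LINT w|lborel. indicator {\<sigma>/2<..} (\<sigma> + 1 * w) * std_normal_density (\<sigma> + 1 * w))"
      by (intro Bochner_Integration.integral_cong) (auto simp: indicator_def add.commute)
    also have "\<dots> = (LINT w|lborel. indicator {\<sigma>/2<..} w * std_normal_density w)"
      by (subst lborel_integral_real_affine[where c=1 and t=\<sigma>]) auto
    also have "\<dots> = (LINT w|lborel. std_normal_density w - indicator {..\<sigma>/2} w * std_normal_density w)"
      by (intro Bochner_Integration.integral_cong) (auto simp: indicator_def)
    also have "\<dots> = 1 - Phi (\<sigma>/2)"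
      unfolding Phi_eq_integral by (subst Bochner_Integration.integral_diff) auto
    finally show ?thesis .
  qed
  have int: "integrable lborel (\<lambda>w. indicator {-\<sigma>/2<..} w * std_normal_density (w + \<sigma>))"
  proof -
    have "integrable lborel (\<lambda>w. std_normal_density (\<sigma> + 1 * w))"
      by (subst lborel_integrable_real_affine_iff) auto
    from integrable_mult_indicator[OF _ this, of "{-\<sigma>/2<..}"] show ?thesis
      by (simp add: add.commute)
  qed
  have "(LINT w|std_normal_distribution. min 1 (exp (- (\<sigma> * w + \<sigma>\<^sup>2/2))))
      = (LINT w|lborel. std_normal_density w *\<^sub>R min 1 (exp (- (\<sigma> * w + \<sigma>\<^sup>2/2))))"
    by (subst integral_density) auto
  also have "\<dots> = (LINT w|lborel. indicator {..-\<sigma>/2} w * std_normal_density w + indicator {-\<sigma>/2<..} w * std_normal_density (w + \<sigma>))"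
    unfolding split ..
  also have "\<dots> = Phi (- \<sigma>/2) + (1 - Phi (\<sigma>/2))"
    using int shift by (simp add: Phi_eq_integral[of "- (\<sigma>/2)"])
  finally show ?thesis using Phi_minus[of "\<sigma>/2"] by simp
qed

section \<open>Time reversal of the leapfrog integrator\<close>

text \<open>The derivative is a linear form, hence an inner product with the vector of its values on
  the basis. Uniqueness of derivatives makes this the vector selected by \<open>THE\<close>.\<close>

lemma GDERIV_grad:
  fixes f :: "real ^ 'm \<Rightarrow> real"
  assumes "f differentiable (at x)"
  shows "GDERIV f x :> grad f x"
proof -
  obtain D where D: "(f has_derivative D) (at x)"
    using assms by (auto simp: differentiable_def)
  interpret D: linear D using D by (rule has_derivative_linear)
  define g where "g = (\<Sum>b\<in>Basis. D b *\<^sub>R b)"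
  have "D h = h \<bullet> g" for h
  proof -
    have "D h = D (\<Sum>b\<in>Basis. (h \<bullet> b) *\<^sub>R b)" by (simp add: euclidean_representation)
    also have "\<dots> = h \<bullet> g"
      by (simp add: D.sum D.scale g_def inner_sum_right mult.commute)
    finally show ?thesis .
  qed
  then have "D = (\<lambda>h. h \<bullet> g)" ..
  with D have g: "GDERIV f x :> g" unfolding gderiv_def by simp
  have "g' = g" if "GDERIV f x :> g'" for g'
  proof -
    have "(\<lambda>h. h \<bullet> g') = (\<lambda>h. h \<bullet> g)"
      using that g unfolding gderiv_def by (rule has_derivative_unique)
    then have "\<forall>h. h \<bullet> g' = h \<bullet> g" by (simp add: fun_eq_iff)
    then show ?thesis by (simp only: vector_eq_ldot)
  qed
  with g show ?thesis unfolding grad_def by (rule theI)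
qed

text \<open>A merely differentiable f may have a discontinuous gradient. Each component is still a
  pointwise limit of difference quotients with increments 1/(n+1), which are continuous in
  x.\<close>

lemma grad_borel_measurable:
  fixes f :: "real ^ 'm \<Rightarrow> real"
  assumes "\<And>x. f differentiable (at x)"
  shows "grad f \<in> borel_measurable borel"
proof -
  have f: "f \<in> borel_measurable borel"
    using assms by (intro borel_measurable_continuous_onI)
      (auto intro!: continuous_at_imp_continuous_on differentiable_imp_continuous_within)
  have "(\<lambda>x. grad f x \<bullet> b) \<in> borel_measurable borel" for b
  proof (rule borel_measurable_LIMSEQ_real)
    fix x :: "real ^ 'm"
    have "((\<lambda>t. f (x + t *\<^sub>R b)) has_derivative (\<lambda>t. (t *\<^sub>R b) \<bullet> grad f x)) (at 0)"
    proof (rule has_derivative_compose[of "\<lambda>t. x + t *\<^sub>R b" "\<lambda>t. t *\<^sub>R b" 0 UNIV f "\<lambda>h. h \<bullet> grad f x"])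
      show "(f has_derivative (\<lambda>h. h \<bullet> grad f x)) (at (x + 0 *\<^sub>R b))"
        using GDERIV_grad[OF assms] by (simp add: gderiv_def)
    qed (auto intro!: derivative_eq_intros)
    then have "((\<lambda>t. f (x + t *\<^sub>R b)) has_real_derivative (grad f x \<bullet> b)) (at 0)"
      by (simp add: has_field_derivative_def inner_commute mult_commute_abs)
    then have "((\<lambda>h. (f (x + h *\<^sub>R b) - f x) / h) \<longlongrightarrow> grad f x \<bullet> b) (at 0)"
      by (simp add: DERIV_def)
    moreover have "filterlim (\<lambda>n. inverse (real (Suc n))) (at 0) sequentially"
      using LIMSEQ_inverse_real_of_nat by (auto simp: filterlim_at)
    ultimately show "(\<lambda>n. (f (x + inverse (real (Suc n)) *\<^sub>R b) - f x) / inverse (real (Suc n)))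
        \<longlonglongrightarrow> grad f x \<bullet> b"
      by (rule filterlim_compose)
  next
    fix n show "(\<lambda>x. (f (x + inverse (real (Suc n)) *\<^sub>R b) - f x) / inverse (real (Suc n))) \<in> borel_measurable borel"
      by (intro borel_measurable_divide borel_measurable_diff f measurable_compose[OF _ f]) auto
  qed
  then show ?thesis
    unfolding borel_measurable_euclidean_space[of "grad f"] by blast
qed

section \<open>Maps that preserve Lebesgue measure\<close>

definition preserves_lborel :: "('a::euclidean_space \<Rightarrow> 'a) \<Rightarrow> bool" where
  "preserves_lborel f \<longleftrightarrow> f \<in> borel_measurable borel \<and> distr lborel borel f = lborel"

lemma preserves_lborel_measurable: "preserves_lborel f \<Longrightarrow> f \<in> borel_measurable borel"
  by (simp add: preserves_lborel_def)

lemma preserves_lborelI: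
  assumes [measurable]: "f \<in> borel_measurable borel"
    and "\<And>g. g \<in> borel_measurable borel \<Longrightarrow> (\<integral>\<^sup>+x. g (f x) \<partial>lborel) = (\<integral>\<^sup>+x. g x \<partial>lborel)"
  shows "preserves_lborel f"
  unfolding preserves_lborel_def
proof (intro conjI measure_eqI)
  fix A assume "A \<in> sets (distr lborel borel f)"
  then have [measurable]: "A \<in> sets borel" by simp
  show "emeasure (distr lborel borel f) A = emeasure lborel A"
    using assms(2)[of "indicator A"]
    by (simp add: nn_integral_distr flip: nn_integral_indicator)
qed (auto simp: assms)

lemma preserves_lborel_comp:
  assumes "preserves_lborel f" "preserves_lborel g"
  shows "preserves_lborel (f \<circ> g)"
  using assms distr_distr[of f borel borel g lborel] by (auto simp: preserves_lborel_def)

lemma preserves_lborel_id: "preserves_lborel id"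
  by (simp add: preserves_lborel_def id_def distr_id2)

lemma preserves_lborel_funpow: "preserves_lborel f \<Longrightarrow> preserves_lborel (f ^^ n)"
  by (induction n) (auto intro: preserves_lborel_id preserves_lborel_comp)

lemma preserves_lborel_integral:
  fixes g :: "'a::euclidean_space \<Rightarrow> real"
  assumes "preserves_lborel f" "g \<in> borel_measurable borel"
  shows "(LINT x|lborel. g (f x)) = (LINT x|lborel. g x)"
  using integral_distr[of f lborel borel g] assms by (auto simp: preserves_lborel_def)

lemma nn_integral_lborel_isometry:
  fixes g :: "'a::euclidean_space \<Rightarrow> ennreal"
  assumes "g \<in> borel_measurable borel" "\<bar>c\<bar> = 1"
  shows "(\<integral>\<^sup>+x. g (t + c *\<^sub>R x) \<partial>lborel) = (\<integral>\<^sup>+x. g x \<partial>lborel)"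
proof -
  have "c \<noteq> 0" using assms by auto
  then have "(lborel :: 'a measure) = density (distr lborel borel (\<lambda>x. t + c *\<^sub>R x)) (\<lambda>_. \<bar>c\<bar> ^ DIM('a))"
    by (rule lborel_affine)
  also have "\<dots> = distr lborel borel (\<lambda>x. t + c *\<^sub>R x)"
    using assms(2) by (simp add: density_1)
  finally have "(\<integral>\<^sup>+x. g x \<partial>lborel) = (\<integral>\<^sup>+x. g x \<partial>distr lborel borel (\<lambda>x. t + c *\<^sub>R x))"
    by (rule arg_cong)
  then show ?thesis using assms(1) by (simp add: nn_integral_distr)
qed

text \<open>By Tonelli it suffices to fix q, where the map in p is a translation, preceded by a
  reflection if c = -1. The case c = 1 serves the kicks, c = -1 the momentum flip.\<close>

lemma preserves_lborel_shear_snd: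
  fixes f :: "'a::euclidean_space \<Rightarrow> 'b::euclidean_space"
  assumes [measurable]: "f \<in> borel_measurable borel" and "\<bar>c\<bar> = 1"
  shows "preserves_lborel (\<lambda>(q, p). (q, f q + c *\<^sub>R p))"
proof (rule preserves_lborelI)
  show "(\<lambda>(q, p). (q, f q + c *\<^sub>R p)) \<in> borel_measurable borel"
    unfolding borel_prod[symmetric] by measurable
next
  fix g :: "'a \<times> 'b \<Rightarrow> ennreal" assume "g \<in> borel_measurable borel"
  then have [measurable]: "g \<in> borel_measurable (borel \<Otimes>\<^sub>M borel)" by (simp add: borel_prod)
  have "(\<integral>\<^sup>+x. g (case x of (q, p) \<Rightarrow> (q, f q + c *\<^sub>R p)) \<partial>lborel)
      = (\<integral>\<^sup>+q. \<integral>\<^sup>+p. g (q, f q + c *\<^sub>R p) \<partial>lborel \<partial>lborel)"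
    unfolding lborel_prod[symmetric] by (subst lborel.nn_integral_fst[symmetric]) auto
  also have "\<dots> = (\<integral>\<^sup>+q. \<integral>\<^sup>+p. g (q, p) \<partial>lborel \<partial>lborel)"
    using assms(2)
    by (intro nn_integral_cong nn_integral_lborel_isometry[of "\<lambda>p. g (_, p)"]) auto
  also have "\<dots> = (\<integral>\<^sup>+x. g x \<partial>lborel)"
    unfolding lborel_prod[symmetric] by (subst lborel.nn_integral_fst) auto
  finally show "(\<integral>\<^sup>+x. g (case x of (q, p) \<Rightarrow> (q, f q + c *\<^sub>R p)) \<partial>lborel) = (\<integral>\<^sup>+x. g x \<partial>lborel)" .
qed

lemma preserves_lborel_swap:
  "preserves_lborel (\<lambda>(q, p). (p, q) :: 'a \<times> 'a :: euclidean_space)"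
proof (rule preserves_lborelI)
  show "(\<lambda>(q, p). (p, q) :: 'a \<times> 'a) \<in> borel_measurable borel"
    unfolding borel_prod[symmetric] by measurable
next
  fix g :: "'a \<times> 'a \<Rightarrow> ennreal" assume "g \<in> borel_measurable borel"
  then have [measurable]: "g \<in> borel_measurable (lborel \<Otimes>\<^sub>M lborel)" by (simp add: lborel_prod)
  show "(\<integral>\<^sup>+x. g (case x of (q, p) \<Rightarrow> (p, q)) \<partial>lborel) = (\<integral>\<^sup>+x. g x \<partial>lborel)"
    unfolding lborel_prod[symmetric]
    using lborel_pair.nn_integral_snd[of g] lborel.nn_integral_fst[of "\<lambda>(q, p). g (p, q)" lborel]
    by (simp add: case_prod_unfold)
qed

text \<open>This is the shear of the second coordinate conjugated by the swap.\<close>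

lemma preserves_lborel_shear_fst:
  fixes f :: "'a::euclidean_space \<Rightarrow> 'a"
  assumes "f \<in> borel_measurable borel"
  shows "preserves_lborel (\<lambda>(q, p). (f p + q, p))"
proof -
  let ?s = "\<lambda>(q, p). (p, q) :: 'a \<times> 'a"
  have eq: "(\<lambda>(q, p). (f p + q, p)) = ?s \<circ> ((\<lambda>(q, p). (q, f q + 1 *\<^sub>R p)) \<circ> ?s)"
    by auto
  show ?thesis
    unfolding eq
    by (intro preserves_lborel_comp preserves_lborel_swap preserves_lborel_shear_snd assms) simp
qed

section \<open>Momentum flip and reversibility of the leapfrog flow\<close>

definition flip :: "('m::finite) phase \<Rightarrow> 'm phase" where
  "flip = (\<lambda>(q, p). (q, - p))"

lemma preserves_lborel_flip: "preserves_lborel flip"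
  using preserves_lborel_shear_snd[of "\<lambda>_. 0" "-1"] by (simp add: flip_def)

lemma matrix_vector_mult_minus_right: "(A :: real ^ 'n ^ 'm) *v (- x) = - (A *v x)"
  using matrix_vector_mult_diff_distrib[of A 0 x] by simp

lemma hamiltonian_flip: "hamiltonian M V (flip x) = hamiltonian M V x"
  by (auto simp: hamiltonian_def flip_def matrix_vector_mult_minus_right split: prod.split)

definition kick :: "(real ^ 'm \<Rightarrow> real) \<Rightarrow> real \<Rightarrow> 'm phase \<Rightarrow> 'm phase" where
  "kick V h = (\<lambda>(q, p). (q, p - (h / 2) *\<^sub>R grad V q))"

definition drift :: "real ^ 'm ^ 'm \<Rightarrow> real \<Rightarrow> 'm phase \<Rightarrow> 'm phase" where
  "drift M h = (\<lambda>(q, p). (q + h *\<^sub>R (matrix_inv M *v p), p))"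

text \<open>The splitting into shears reduces both measure preservation and reversibility to the
  separate factors; its palindromic form lets the reversals telescope.\<close>

lemma leapfrog_eq: "leapfrog M V h = kick V h \<circ> drift M h \<circ> kick V h"
  by (auto simp: leapfrog_def kick_def drift_def Let_def fun_eq_iff)

lemma kick_flip_kick: "kick V h (flip (kick V h x)) = flip x"
  by (auto simp: kick_def flip_def split: prod.split)

lemma drift_flip_drift: "drift M h (flip (drift M h x)) = flip x"
  by (auto simp: drift_def flip_def matrix_vector_mult_minus_right split: prod.split)

lemma leapfrog_flip_leapfrog: "leapfrog M V h (flip (leapfrog M V h x)) = flip x"
  by (simp add: leapfrog_eq kick_flip_kick drift_flip_drift)

lemma funpow_flip_funpow:
  assumes "\<And>x. f (flip (f x)) = flip x"
  shows "(f ^^ n) (flip ((f ^^ n) x)) = flip x"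
proof (induction n arbitrary: x)
  case (Suc n)
  \<comment> \<open>One application is split off at the outside and one at the inside, so that the
    induction hypothesis applies at \<open>f x\<close>.\<close>
  have "(f ^^ Suc n) (flip ((f ^^ Suc n) x)) = f ((f ^^ n) (flip ((f ^^ n) (f x))))"
    by (simp add: funpow_swap1)
  also have "\<dots> = flip x" by (simp only: Suc assms)
  finally show ?case .
qed simp

text \<open>Flow, flip and flow again end at \<open>flip x\<close>, so the initial and final
  energies exchange their roles.\<close>

lemma energy_error_reverse:
  "energy_error M V T (flip (leapfrog_flow M V T h x)) h = - energy_error M V T x h"
  unfolding energy_error_def leapfrog_flow_def
  by (simp add: funpow_flip_funpow leapfrog_flip_leapfrog hamiltonian_flip)

context
  fixes M :: "real ^ 'm ^ 'm" and V :: "real ^ 'm \<Rightarrow> real"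
  assumes V: "\<And>q. V differentiable (at q)"
begin

lemma borel_measurable_hamiltonian: "hamiltonian M V \<in> borel_measurable borel"
proof -
  have "continuous_on UNIV V"
    using V by (auto intro!: continuous_at_imp_continuous_on differentiable_imp_continuous_within)
  then have "continuous_on UNIV (\<lambda>x::'m phase. V (fst x))"
    by (rule continuous_on_compose2) (auto intro: continuous_on_fst continuous_on_id)
  moreover have "continuous_on UNIV (\<lambda>x::'m phase. matrix_inv M *v snd x)"
    by (rule continuous_on_compose2[OF matrix_vector_mult_linear_continuous_on[of UNIV]])
      (auto intro: continuous_on_snd continuous_on_id)
  ultimately have "continuous_on UNIV (hamiltonian M V)"
    unfolding hamiltonian_def case_prod_unfold
    by (intro continuous_on_add continuous_on_divide continuous_on_inner continuous_on_snd
        continuous_on_id continuous_on_const) auto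
  then show ?thesis by (rule borel_measurable_continuous_onI)
qed

lemma preserves_lborel_leapfrog_flow: "preserves_lborel (leapfrog_flow M V T h)"
proof -
  note g = grad_borel_measurable[of V, OF V]
  have "(\<lambda>(q, p). (q, (- (h / 2)) *\<^sub>R grad V q + 1 *\<^sub>R p)) = kick V h"
    by (auto simp: kick_def)
  moreover have "preserves_lborel (\<lambda>(q, p). (q, (- (h / 2)) *\<^sub>R grad V q + 1 *\<^sub>R p))"
    using g by (intro preserves_lborel_shear_snd) auto
  ultimately have k: "preserves_lborel (kick V h)" by simp
  have "(\<lambda>(q, p). (h *\<^sub>R (matrix_inv M *v p) + q, p)) = drift M h"
    by (auto simp: drift_def)
  moreover have "preserves_lborel (\<lambda>(q, p). (h *\<^sub>R (matrix_inv M *v p) + q, p))"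
    by (intro preserves_lborel_shear_fst borel_measurable_continuous_onI continuous_on_scaleR
        continuous_on_const matrix_vector_mult_linear_continuous_on)
  ultimately have d: "preserves_lborel (drift M h)" by simp
  have "preserves_lborel (leapfrog M V h)"
    unfolding leapfrog_eq by (rule preserves_lborel_comp[OF preserves_lborel_comp[OF k d] k])
  then show ?thesis
    unfolding leapfrog_flow_def by (rule preserves_lborel_funpow)
qed

lemma borel_measurable_energy_error: "(\<lambda>x. energy_error M V T x h) \<in> borel_measurable borel"
  unfolding energy_error_def
  by (rule borel_measurable_diff[OF measurable_compose[OF preserves_lborel_measurable[OF
        preserves_lborel_leapfrog_flow] borel_measurable_hamiltonian] borel_measurable_hamiltonian])

lemma integral_target:
  fixes g :: "'m phase \<Rightarrow> real"
  assumes "g \<in> borel_measurable borel"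
  shows "(LINT x|target M V. g x)
    = (LINT x|lborel. exp (- hamiltonian M V x) / (LINT y|lborel. exp (- hamiltonian M V y)) * g x)"
  unfolding target_def using assms borel_measurable_hamiltonian
  by (subst integral_density) (auto intro!: Bochner_Integration.integral_nonneg)

text \<open>Change of variables by the flow followed by the flip: it preserves Lebesgue measure,
  turns H into H + \<Delta> in the weight exp(-H), and turns \<Delta> into -\<Delta>.\<close>

lemma integral_target_reverse:
  assumes f: "f \<in> borel_measurable borel"
  shows "(LINT x|target M V. f (energy_error M V T x h))
    = (LINT x|target M V. f (- energy_error M V T x h) * exp (- energy_error M V T x h))"
proof -
  let ?\<Delta> = "\<lambda>x. energy_error M V T x h" and ?Z = "LINT y|lborel. exp (- hamiltonian M V y)"
  let ?J = "flip \<circ> leapfrog_flow M V T h"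
  note [measurable] = borel_measurable_hamiltonian borel_measurable_energy_error f
  have J: "preserves_lborel ?J"
    by (intro preserves_lborel_comp preserves_lborel_flip preserves_lborel_leapfrog_flow)
  have H: "hamiltonian M V (?J x) = hamiltonian M V x + ?\<Delta> x" for x
    by (simp add: hamiltonian_flip energy_error_def)
  have "(LINT x|target M V. f (?\<Delta> x)) = (LINT x|lborel. exp (- hamiltonian M V x) / ?Z * f (?\<Delta> x))"
    by (rule integral_target) measurable
  also have "\<dots> = (LINT x|lborel. exp (- hamiltonian M V (?J x)) / ?Z * f (?\<Delta> (?J x)))"
    by (rule preserves_lborel_integral[OF J, symmetric]) measurable
  also have "\<dots> = (LINT x|lborel. exp (- hamiltonian M V x) / ?Z * (f (- ?\<Delta> x) * exp (- ?\<Delta> x)))"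
    unfolding H by (simp add: energy_error_reverse exp_add exp_diff exp_minus field_simps)
  also have "\<dots> = (LINT x|target M V. f (- ?\<Delta> x) * exp (- ?\<Delta> x))"
    by (rule integral_target[symmetric]) measurable
  finally show ?thesis .
qed

end

section \<open>Limit of the mean acceptance probability\<close>

text \<open>The comparison is with exp(w/n), whose n-th power is exp w. Since Re w \<le> 0, both
  bases lie in the closed unit disc, where n-th powers differ by at most n times the distance of the
  bases, and that tends to 0.\<close>

lemma power_tendsto_exp:
  fixes z :: "nat \<Rightarrow> complex"
  assumes lim: "(\<lambda>n. of_nat n * (z n - 1)) \<longlonglongrightarrow> w" and z: "\<And>n. norm (z n) \<le> 1" and w: "Re w \<le> 0"
  shows "(\<lambda>n. z n ^ n) \<longlonglongrightarrow> exp w"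
proof -
  have "((\<lambda>h. exp (h * w)) has_field_derivative w) (at 0)"
    by (auto intro!: derivative_eq_intros)
  then have "((\<lambda>h. (exp (h * w) - 1) / h) \<longlongrightarrow> w) (at 0)"
    by (simp add: DERIV_def)
  moreover have "filterlim (\<lambda>n. 1 / of_nat n :: complex) (at 0) sequentially"
    using lim_1_over_n eventually_gt_at_top[of "0::nat"]
    by (auto simp: filterlim_at elim!: eventually_mono)
  ultimately have "(\<lambda>n. (exp (1 / of_nat n * w) - 1) / (1 / of_nat n)) \<longlonglongrightarrow> w"
    by (rule filterlim_compose)
  then have e: "(\<lambda>n. of_nat n * (exp (w / of_nat n) - 1)) \<longlonglongrightarrow> w"
    by (simp add: mult.commute)
  have "(\<lambda>n. norm (of_nat n * (z n - 1) - of_nat n * (exp (w / of_nat n) - 1))) \<longlonglongrightarrow> norm (w - w)"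
    by (intro tendsto_norm tendsto_diff lim e)
  then have null: "(\<lambda>n. norm (of_nat n * (z n - 1) - of_nat n * (exp (w / of_nat n) - 1))) \<longlonglongrightarrow> 0" by simp
  have bound: "norm (z n ^ n - exp (w / of_nat n) ^ n)
      \<le> norm (of_nat n * (z n - 1) - of_nat n * (exp (w / of_nat n) - 1))" for n
  proof -
    have "norm (exp (w / of_nat n)) \<le> 1"
      using w by (simp add: divide_nonpos_nonneg)
    then have "norm (z n ^ n - exp (w / of_nat n) ^ n) \<le> real n * norm (z n - exp (w / of_nat n))"
      using z by (intro norm_power_diff)
    also have "\<dots> = norm (of_nat n * (z n - exp (w / of_nat n)))"
      by (simp add: norm_mult)
    also have "of_nat n * (z n - exp (w / of_nat n)) = of_nat n * (z n - 1) - of_nat n * (exp (w / of_nat n) - 1)"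
      by (simp add: algebra_simps)
    finally show ?thesis .
  qed
  have "(\<lambda>n. z n ^ n - exp (w / of_nat n) ^ n) \<longlonglongrightarrow> 0"
    using Lim_null_comparison[OF always_eventually[OF allI[OF bound]] null] .
  moreover have "\<forall>\<^sub>F n in sequentially. z n ^ n - exp (w / of_nat n) ^ n = z n ^ n - exp w"
    using eventually_gt_at_top[of 0]
    by eventually_elim (simp flip: exp_of_nat_mult)
  ultimately have "(\<lambda>n. z n ^ n - exp w) \<longlonglongrightarrow> 0"
    by (simp add: tendsto_cong)
  then show ?thesis by (simp add: LIM_zero_iff)
qed

lemma quadratic_rescaling_tendsto:
  fixes g :: "real \<Rightarrow> real"
  assumes g: "((\<lambda>y. g y / y\<^sup>2) \<longlongrightarrow> L) (at 0)" "g 0 = 0"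
    and h: "h \<longlonglongrightarrow> 0" "\<And>n. h n \<noteq> 0" and u: "(\<lambda>n. u n / (h n)\<^sup>2) \<longlonglongrightarrow> a"
  shows "(\<lambda>n. g (u n) / (h n)^4) \<longlonglongrightarrow> L * a\<^sup>2"
proof -
  \<comment> \<open>The values \<open>u n\<close> may be 0, so the quotient is extended continuously
    by its limit L.\<close>
  define k where "k y = (if y = 0 then L else g y / y\<^sup>2)" for y
  have "isCont k 0"
    unfolding isCont_def by (rule tendsto_eq_rhs[OF Lim_transform_eventually[OF g(1)]])
      (auto simp: k_def eventually_at_filter)
  moreover have "u \<longlonglongrightarrow> 0"
  proof -
    have "(\<lambda>n. u n / (h n)\<^sup>2 * (h n)\<^sup>2) \<longlonglongrightarrow> a * 0\<^sup>2"
      by (intro tendsto_mult u tendsto_power h)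
    then show ?thesis using h(2) by simp
  qed
  ultimately have "(\<lambda>n. k (u n)) \<longlonglongrightarrow> L"
    using isCont_tendsto_compose[of 0 k u] by (simp add: k_def)
  then have "(\<lambda>n. k (u n) * (u n / (h n)\<^sup>2)\<^sup>2) \<longlonglongrightarrow> L * a\<^sup>2"
    by (intro tendsto_mult tendsto_power u)
  moreover have "k y * (y / (h n)\<^sup>2)\<^sup>2 = g y / (h n)^4" for y n
    using g(2) by (simp add: k_def power_divide flip: power_mult)
  ultimately show ?thesis by simp
qed

section \<open>Quadratic bounds and expansions of the test functions\<close>

lemma cos_minus_1_le: "\<bar>cos y - 1\<bar> \<le> y\<^sup>2 / 2" for y :: real
proof -
  have "\<bar>cos y - 1\<bar> = 2 * \<bar>sin (y/2)\<bar>\<^sup>2"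
    using cos_double_sin[of "y/2"] by simp
  also have "\<dots> \<le> 2 * \<bar>y/2\<bar>\<^sup>2"
    by (intro mult_left_mono power_mono abs_sin_x_le_abs_x) auto
  finally show ?thesis by (simp add: power_divide)
qed

lemma cos_minus_1_quadratic: "((\<lambda>y. (cos (t * y) - 1) / y\<^sup>2) \<longlongrightarrow> - t\<^sup>2 / 2) (at 0)" for t :: real
proof -
  have "((\<lambda>y. sin (t/2 * y)) has_real_derivative t/2) (at 0)"
    by (auto intro!: derivative_eq_intros)
  then have "((\<lambda>y. sin (t/2 * y) / y) \<longlongrightarrow> t/2) (at 0)"
    by (simp add: DERIV_def)
  then have "((\<lambda>y. - 2 * (sin (t/2 * y) / y)\<^sup>2) \<longlongrightarrow> - 2 * (t/2)\<^sup>2) (at 0)"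
    by (rule tendsto_mult[OF tendsto_const tendsto_power])
  moreover have "- 2 * (sin (t/2 * y) / y)\<^sup>2 = (cos (t * y) - 1) / y\<^sup>2" for y
    using cos_double_sin[of "t/2 * y"] by (simp add: power_divide)
  ultimately show ?thesis by (simp add: power_divide)
qed

text \<open>Equivalently 1 - 2/(1 + exp y), the form in which time reversal produces it.\<close>

definition tanh_half :: "real \<Rightarrow> real" where
  "tanh_half y = (exp y - 1) / (exp y + 1)"

lemma tanh_half_borel_measurable [measurable]: "tanh_half \<in> borel_measurable borel"
  unfolding tanh_half_def by measurable

lemma tanh_half_le: "\<bar>tanh_half y\<bar> \<le> \<bar>y\<bar>"
proof -
  \<comment> \<open>For y \<le> 0 the denominator is at least 1 and \<open>1 - exp y\<close> is at
    most -y; oddness then covers y > 0.\<close>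
  have *: "\<bar>tanh_half y\<bar> \<le> \<bar>y\<bar>" if "y \<le> 0" for y
  proof -
    have p: "0 < exp y + 1" by (rule add_pos_pos) auto
    have "\<bar>tanh_half y\<bar> = (1 - exp y) / (exp y + 1)"
      using that p by (simp add: tanh_half_def abs_divide)
    also have "\<dots> \<le> (1 - exp y) / 1"
      using that p by (intro divide_left_mono) auto
    also have "\<dots> = 1 - exp y" by simp
    also have "\<dots> \<le> \<bar>y\<bar>" unfolding abs_of_nonpos[OF that] using exp_ge_add_one_self[of y] by linarith
    finally show ?thesis .
  qed
  have "\<bar>tanh_half (- y)\<bar> = \<bar>tanh_half y\<bar>"
  proof -
    have "exp (- y) - 1 = - (exp y - 1) / exp y" "exp (- y) + 1 = (exp y + 1) / exp y"
      by (simp_all add: exp_minus field_simps)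
    then have "tanh_half (- y) = - tanh_half y"
      using minus_divide_left[of "exp y - 1" "exp y + 1"] by (simp add: tanh_half_def)
    then show ?thesis by simp
  qed
  with *[of y] *[of "- y"] show ?thesis by (cases "y \<le> 0") auto
qed

lemma sin_tanh_half_quadratic: "((\<lambda>y. (sin (t * y) * tanh_half y) / y\<^sup>2) \<longlongrightarrow> t / 2) (at 0)" for t :: real
proof -
  have "((\<lambda>y. sin (t * y)) has_real_derivative t) (at 0)"
    by (auto intro!: derivative_eq_intros)
  then have "((\<lambda>y. sin (t * y) / y) \<longlongrightarrow> t) (at 0)"
    by (simp add: DERIV_def)
  moreover have "(tanh_half has_real_derivative 1/2) (at 0)"
    unfolding tanh_half_def[abs_def] by (auto intro!: derivative_eq_intros)
  then have "((\<lambda>y. tanh_half y / y) \<longlongrightarrow> 1/2) (at 0)"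
    by (simp add: DERIV_def) (simp add: tanh_half_def)
  ultimately have "((\<lambda>y. (sin (t * y) / y) * (tanh_half y / y)) \<longlongrightarrow> t * (1/2)) (at 0)"
    by (rule tendsto_mult)
  then show ?thesis by (simp add: power2_eq_square)
qed

text \<open>The assumption \<open>balance\<close> is all that is needed of reversibility: it trades the odd part of the
  characteristic function of the error, of apparent order \<open>h\<^sup>2\<close>, for a term that is visibly of order
  \<open>h\<^sup>4\<close>.\<close>

locale balanced_error = prob_space P for P :: "'a measure" +
  fixes \<Delta> :: "'a \<Rightarrow> real \<Rightarrow> real" and \<alpha> D :: "'a \<Rightarrow> real"
  assumes measurable_error [measurable]: "\<And>h. (\<lambda>x. \<Delta> x h) \<in> borel_measurable P"
    and error_tendsto: "\<And>x. ((\<lambda>h. \<Delta> x h / h\<^sup>2) \<longlongrightarrow> \<alpha> x) (at_right 0)"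
    and integrable_dom: "integrable P D"
    and error_dom: "AE x in P. \<forall>h. 0 < h \<longrightarrow> h \<le> 1 \<longrightarrow> (\<Delta> x h)\<^sup>2 \<le> h^4 * D x"
    and balance: "\<And>h t. 0 < h \<Longrightarrow> expectation (\<lambda>x. sin (t * \<Delta> x h)) = expectation (\<lambda>x. sin (t * \<Delta> x h) * tanh_half (\<Delta> x h))"
    and variance_pos: "0 < expectation (\<lambda>x. (\<alpha> x)\<^sup>2)"
begin

lemma error_tendsto_seq:
  assumes "h \<longlonglongrightarrow> 0" "\<And>n. 0 < h n"
  shows "(\<lambda>n. \<Delta> x (h n) / (h n)\<^sup>2) \<longlonglongrightarrow> \<alpha> x"
  by (rule filterlim_compose[OF error_tendsto]) (use assms in \<open>auto simp: filterlim_at less_imp_neq[symmetric]\<close>)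

lemma measurable_limit [measurable]: "\<alpha> \<in> borel_measurable P"
proof (rule borel_measurable_LIMSEQ_real)
  show "(\<lambda>n. \<Delta> x (inverse (real (Suc n))) / (inverse (real (Suc n)))\<^sup>2) \<longlonglongrightarrow> \<alpha> x" for x
    using LIMSEQ_inverse_real_of_nat by (rule error_tendsto_seq) auto
qed measurable

text \<open>Near 0, g(\<Delta>) behaves like L \<Delta>^2, and \<Delta> like h^2 \<alpha>, whence
  the scale h^4. The quadratic bound on g and \<open>error_dom\<close> yield a multiple of D as
  dominating function.\<close>

lemma expectation_quadratic_tendsto:
  fixes g :: "real \<Rightarrow> real"
  assumes g: "((\<lambda>y. g y / y\<^sup>2) \<longlongrightarrow> L) (at 0)" "\<And>y. \<bar>g y\<bar> \<le> C * y\<^sup>2"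
    and [measurable]: "g \<in> borel_measurable borel"
    and h: "h \<longlonglongrightarrow> 0" "\<And>n. 0 < h n" "\<And>n. h n \<le> 1"
  shows "(\<lambda>n. expectation (\<lambda>x. g (\<Delta> x (h n))) / (h n)^4) \<longlonglongrightarrow> L * expectation (\<lambda>x. (\<alpha> x)\<^sup>2)"
proof -
  have "(\<lambda>n. expectation (\<lambda>x. g (\<Delta> x (h n)) / (h n)^4)) \<longlonglongrightarrow> expectation (\<lambda>x. L * (\<alpha> x)\<^sup>2)"
  proof (rule integral_dominated_convergence)
    show "integrable P (\<lambda>x. \<bar>C\<bar> * D x)" using integrable_dom by simp
    have "g 0 = 0" using g(2)[of 0] by simp
    then show "AE x in P. (\<lambda>n. g (\<Delta> x (h n)) / (h n)^4) \<longlonglongrightarrow> L * (\<alpha> x)\<^sup>2"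
      using g(1) h error_tendsto_seq[OF h(1,2)]
      by (intro always_eventually allI quadratic_rescaling_tendsto) (auto simp: less_imp_neq[symmetric])
    show "AE x in P. norm (g (\<Delta> x (h n)) / (h n)^4) \<le> \<bar>C\<bar> * D x" for n
      using error_dom
    proof eventually_elim
      case (elim x)
      have "\<bar>g (\<Delta> x (h n))\<bar> \<le> \<bar>C\<bar> * (\<Delta> x (h n))\<^sup>2"
        using g(2)[of "\<Delta> x (h n)"] mult_right_mono[OF abs_ge_self zero_le_power2, of C "\<Delta> x (h n)"]
        by linarith
      also have "\<dots> \<le> \<bar>C\<bar> * ((h n)^4 * D x)"
        using elim h by (intro mult_left_mono) auto
      finally show ?case using h(2)[of n] by (simp add: divide_le_eq ac_simps)
    qed
  qed measurable
  then show ?thesis by simp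
qed

text \<open>The cosine part has order h^4 directly. The sine part divided by h^4 generally diverges
  pointwise, so it is replaced through \<open>balance\<close> before the limit is taken.\<close>

lemma char_tendsto:
  fixes t :: real
  assumes h: "h \<longlonglongrightarrow> 0" "\<And>n. 0 < h n" "\<And>n. h n \<le> 1"
  defines "\<phi> n \<equiv> (CLINT x|P. iexp (t * \<Delta> x (h n)))"
  shows "(\<lambda>n. (\<phi> n - 1) / (h n)^4) \<longlonglongrightarrow> (\<i> * t - t\<^sup>2) / 2 * expectation (\<lambda>x. (\<alpha> x)\<^sup>2)"
proof -
  let ?v = "expectation (\<lambda>x. (\<alpha> x)\<^sup>2)"
  have int_cos: "integrable P (\<lambda>x. cos (t * \<Delta> x (h n)))" and int_sin: "integrable P (\<lambda>x. sin (t * \<Delta> x (h n)))" for n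
    by (auto intro!: integrable_const_bound[where B=1])
  have \<phi>: "\<phi> n = of_real (expectation (\<lambda>x. cos (t * \<Delta> x (h n)))) + \<i> * of_real (expectation (\<lambda>x. sin (t * \<Delta> x (h n))))" for n
  proof -
    have "\<phi> n = (CLINT x|P. of_real (cos (t * \<Delta> x (h n))) + \<i> * of_real (sin (t * \<Delta> x (h n))))"
      unfolding \<phi>_def by (simp only: cis_conv_exp[symmetric] cis.code Complex_eq)
    also have "\<dots> = (CLINT x|P. of_real (cos (t * \<Delta> x (h n)))) + (CLINT x|P. \<i> * of_real (sin (t * \<Delta> x (h n))))"
      using int_cos int_sin by (intro Bochner_Integration.integral_add integrable_of_real integrable_mult_right) 
    finally show ?thesis by (simp add: integral_complex_of_real)
  qed
  have 1: "(\<lambda>n. expectation (\<lambda>x. cos (t * \<Delta> x (h n)) - 1) / (h n)^4) \<longlonglongrightarrow> - t\<^sup>2 / 2 * ?v"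
    using cos_minus_1_le
    by (intro expectation_quadratic_tendsto[where g="\<lambda>y. cos (t * y) - 1" and C="t\<^sup>2/2"] cos_minus_1_quadratic h)
      (auto simp: power_mult_distrib[symmetric])
  have 2: "(\<lambda>n. expectation (\<lambda>x. sin (t * \<Delta> x (h n)) * tanh_half (\<Delta> x (h n))) / (h n)^4) \<longlonglongrightarrow> t / 2 * ?v"
  proof (intro expectation_quadratic_tendsto[where g="\<lambda>y. sin (t * y) * tanh_half y" and C="\<bar>t\<bar>"] sin_tanh_half_quadratic h)
    fix y
    have "\<bar>sin (t * y) * tanh_half y\<bar> \<le> \<bar>t * y\<bar> * \<bar>y\<bar>"
      unfolding abs_mult[of "sin _"] by (intro mult_mono abs_sin_x_le_abs_x tanh_half_le) auto
    then show "\<bar>sin (t * y) * tanh_half y\<bar> \<le> \<bar>t\<bar> * y\<^sup>2"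
      by (simp add: abs_mult power2_eq_square mult.assoc)
  qed measurable
  have lim: "(\<lambda>n. of_real (expectation (\<lambda>x. cos (t * \<Delta> x (h n)) - 1) / (h n)^4)
      + \<i> * of_real (expectation (\<lambda>x. sin (t * \<Delta> x (h n)) * tanh_half (\<Delta> x (h n))) / (h n)^4))
      \<longlonglongrightarrow> of_real (- t\<^sup>2 / 2 * ?v) + \<i> * of_real (t / 2 * ?v)"
    by (intro tendsto_add tendsto_mult tendsto_of_real tendsto_const 1 2)
  have eq: "(\<phi> n - 1) / (h n)^4 = of_real (expectation (\<lambda>x. cos (t * \<Delta> x (h n)) - 1) / (h n)^4)
      + \<i> * of_real (expectation (\<lambda>x. sin (t * \<Delta> x (h n)) * tanh_half (\<Delta> x (h n))) / (h n)^4)" for n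
    unfolding \<phi> balance[OF h(2), symmetric] using int_cos[of n]
    by (simp add: prob_space add_divide_distrib diff_divide_distrib)
  have eq_lim: "of_real (- t\<^sup>2 / 2 * ?v) + \<i> * of_real (t / 2 * ?v) = (\<i> * t - t\<^sup>2) / 2 * ?v"
    by (simp add: field_simps)
  show ?thesis unfolding eq using lim[unfolded eq_lim] .
qed

lemma mean_acceptance_tendsto:
  fixes l :: real
  assumes "0 < l"
  shows "(\<lambda>d. LINT X|(\<Pi>\<^sub>M i\<in>{..<d}. P). min 1 (exp (- (\<Sum>i<d. \<Delta> (X i) (l * real d powr (-1/4))))))
    \<longlonglongrightarrow> 2 * Phi (- l\<^sup>2 * sqrt (expectation (\<lambda>x. (\<alpha> x)\<^sup>2)) / 2)"
proof -
  define S where "S = expectation (\<lambda>x. (\<alpha> x)\<^sup>2)"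
  define \<sigma> where "\<sigma> = l\<^sup>2 * sqrt S"
  define h where "h d = l * real d powr (-1/4)" for d
  define \<phi> where "\<phi> d t = (CLINT x|P. iexp (t * \<Delta> x (h d)))" for d t
  \<comment> \<open>The total error is centred and scaled by its limiting mean and standard
    deviation, so that the limit law is standard normal.\<close>
  define W where "W d X = ((\<Sum>i<d. \<Delta> (X i) (h d)) - \<sigma>\<^sup>2/2) / \<sigma>" for d X
  let ?PM = "\<lambda>d::nat. \<Pi>\<^sub>M i\<in>{..<d}. P"
  have S: "0 < S" using variance_pos by (simp add: S_def)
  have \<sigma>: "0 < \<sigma>" using S assms by (simp add: \<sigma>_def)
  have \<sigma>2: "\<sigma>\<^sup>2 = l^4 * S" using S by (simp add: \<sigma>_def power_mult_distrib flip: power_mult)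
  have h_pos: "0 < h d" if "0 < d" for d using that assms by (simp add: h_def)
  \<comment> \<open>This identity is the reason for the exponent -1/4: d factors, each deviating
    from 1 by order h^4, give a nondegenerate limit.\<close>
  have h4: "real d * (h d)^4 = l^4" if "0 < d" for d
  proof -
    have "(real d powr (-1/4))^4 = real d powr (-1)"
      using that by (subst powr_power) auto
    then have "(real d powr (-1/4))^4 = 1 / real d"
      using that by (simp only: powr_minus_divide) simp
    then show ?thesis
      unfolding h_def power_mult_distrib using that by (simp only:) simp
  qed
  have h_lim: "h \<longlonglongrightarrow> 0"
  proof -
    have "(\<lambda>d. real d powr (-1/4)) \<longlonglongrightarrow> 0"
      by (rule tendsto_neg_powr) (auto simp: filterlim_real_sequentially)
    then show ?thesis unfolding h_def using tendsto_mult_right_zero by blast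
  qed
  have \<phi>_lim: "(\<lambda>d. \<phi> d t ^ d) \<longlonglongrightarrow> exp ((\<i> * t - t\<^sup>2) / 2 * \<sigma>\<^sup>2)" for t
  proof (rule power_tendsto_exp)
    have "eventually (\<lambda>d. h d < 1) sequentially"
      using order_tendstoD(2)[OF h_lim] by simp
    then obtain N where N: "\<And>d. d \<ge> N \<Longrightarrow> h d < 1" by (auto simp: eventually_sequentially)
    \<comment> \<open>The shift enforces h \<le> 1 and also skips d = 0, where \<open>powr\<close>
      gives the step size 0.\<close>
    have "(\<lambda>d. (\<phi> (d + Suc N) t - 1) / (h (d + Suc N))^4) \<longlonglongrightarrow> (\<i> * t - t\<^sup>2) / 2 * S"
      unfolding \<phi>_def S_def
      using h_pos N by (intro char_tendsto LIMSEQ_ignore_initial_segment[OF h_lim] less_imp_le) auto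
    then have "(\<lambda>d. (\<phi> d t - 1) / (h d)^4) \<longlonglongrightarrow> (\<i> * t - t\<^sup>2) / 2 * S"
      by (rule LIMSEQ_offset)
    then have "(\<lambda>d. of_real (l^4) * ((\<phi> d t - 1) / (h d)^4)) \<longlonglongrightarrow> of_real (l^4) * ((\<i> * t - t\<^sup>2) / 2 * S)"
      by (intro tendsto_mult tendsto_const)
    moreover have "\<forall>\<^sub>F d in sequentially. of_real (l^4) * ((\<phi> d t - 1) / (h d)^4) = of_nat d * (\<phi> d t - 1)"
      using eventually_gt_at_top[of 0]
    proof eventually_elim
      case (elim d)
      have "of_real (l^4) * ((\<phi> d t - 1) / (h d)^4) = of_real (real d * (h d)^4) * ((\<phi> d t - 1) / (h d)^4)"
        unfolding h4[OF elim] ..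
      also have "\<dots> = of_nat d * (\<phi> d t - 1)"
        using h_pos[OF elim] by simp
      finally show ?case .
    qed
    ultimately have "(\<lambda>d. of_nat d * (\<phi> d t - 1)) \<longlonglongrightarrow> of_real (l^4) * ((\<i> * t - t\<^sup>2) / 2 * S)"
      by (simp add: tendsto_cong)
    then show "(\<lambda>d. of_nat d * (\<phi> d t - 1)) \<longlonglongrightarrow> (\<i> * t - t\<^sup>2) / 2 * \<sigma>\<^sup>2"
      by (simp only: \<sigma>2 of_real_mult of_real_power ac_simps flip: of_real_power)
    show "norm (\<phi> d t) \<le> 1" for d
    proof -
      have "norm (\<phi> d t) \<le> (LINT x|P. norm (iexp (t * \<Delta> x (h d))))"
        unfolding \<phi>_def by (rule integral_norm_bound)
      then show ?thesis by (simp add: prob_space)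
    qed
    have "(\<i> * t - t\<^sup>2) / 2 * \<sigma>\<^sup>2 = of_real (- t\<^sup>2 / 2 * \<sigma>\<^sup>2) + \<i> * of_real (t / 2 * \<sigma>\<^sup>2)"
      by (simp add: field_simps)
    then have "Re ((\<i> * t - t\<^sup>2) / 2 * \<sigma>\<^sup>2) = - t\<^sup>2 / 2 * \<sigma>\<^sup>2" by simp
    then show "Re ((\<i> * t - t\<^sup>2) / 2 * \<sigma>\<^sup>2) \<le> 0" by simp
  qed
  have PM: "prob_space (?PM d)" for d
    by (intro prob_space_PiM prob_space_axioms)
  have W [measurable]: "W d \<in> borel_measurable (?PM d)" for d
    unfolding W_def[abs_def] by measurable
  \<comment> \<open>Independence under the product measure turns the characteristic function into a
    d-th power; centring contributes the prefactor.\<close>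
  have char_W: "char (distr (?PM d) borel (W d)) t = iexp (- (t * \<sigma> / 2)) * \<phi> d (t / \<sigma>) ^ d" for d t
  proof -
    interpret product_sigma_finite "\<lambda>_::nat. P"
      by (rule product_sigma_finite.intro) (rule sigma_finite_measure_axioms)
    have "char (distr (?PM d) borel (W d)) t = (CLINT X|?PM d. iexp (t * W d X))"
      unfolding char_def by (subst integral_distr) auto
    also have "\<dots> = (CLINT X|?PM d. iexp (- (t * \<sigma> / 2)) * (\<Prod>i<d. iexp (t / \<sigma> * \<Delta> (X i) (h d))))"
    proof (rule Bochner_Integration.integral_cong[OF refl])
      fix X
      have "t * W d X = - (t * \<sigma> / 2) + (\<Sum>i<d. t / \<sigma> * \<Delta> (X i) (h d))"
        unfolding sum_distrib_left[symmetric] using \<sigma> by (simp add: W_def field_simps power2_eq_square)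
      then show "iexp (t * W d X) = iexp (- (t * \<sigma> / 2)) * (\<Prod>i<d. iexp (t / \<sigma> * \<Delta> (X i) (h d)))"
        by (simp only: of_real_add of_real_sum distrib_left exp_add sum_distrib_left exp_sum[OF finite_lessThan])
    qed
    also have "\<dots> = iexp (- (t * \<sigma> / 2)) * (\<Prod>i<d. (CLINT x|P. iexp (t / \<sigma> * \<Delta> x (h d))))"
      unfolding integral_mult_right_zero
      by (subst product_integral_prod[OF finite_lessThan]) (rule integrable_iexp, measurable)
    finally show ?thesis by (simp add: \<phi>_def)
  qed
  have "weak_conv_m (\<lambda>d. distr (?PM d) borel (W d)) std_normal_distribution"
  proof (rule levy_continuity)
    show "real_distribution (distr (?PM d) borel (W d))" for d
      using PM by (rule prob_space.real_distribution_distr) (rule W)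
    fix t
    have "(\<lambda>d. iexp (- (t * \<sigma> / 2)) * \<phi> d (t / \<sigma>) ^ d)
        \<longlonglongrightarrow> iexp (- (t * \<sigma> / 2)) * exp ((\<i> * (t / \<sigma>) - (t / \<sigma>)\<^sup>2) / 2 * \<sigma>\<^sup>2)"
      using \<phi>_lim[of "t / \<sigma>"] by (intro tendsto_mult tendsto_const) simp
    \<comment> \<open>The prefactor cancels the imaginary term i t \<sigma>/2 of the exponent and
      leaves -t^2/2.\<close>
    also have "iexp (- (t * \<sigma> / 2)) * exp ((\<i> * (t / \<sigma>) - (t / \<sigma>)\<^sup>2) / 2 * \<sigma>\<^sup>2) = char std_normal_distribution t"
      using \<sigma> unfolding char_std_normal_distribution
      by (simp add: exp_of_real[symmetric] mult_exp_exp field_simps power2_eq_square)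
    finally show "(\<lambda>d. char (distr (?PM d) borel (W d)) t) \<longlonglongrightarrow> char std_normal_distribution t"
      unfolding char_W .
  qed (rule real_dist_normal_dist)
  \<comment> \<open>The acceptance probability is a bounded continuous function of W, so weak
    convergence carries over to its mean.\<close>
  then have "(\<lambda>d. LINT w|distr (?PM d) borel (W d). min 1 (exp (- (\<sigma> * w + \<sigma>\<^sup>2/2))))
      \<longlonglongrightarrow> (LINT w|std_normal_distribution. min 1 (exp (- (\<sigma> * w + \<sigma>\<^sup>2/2))))"
  proof (rule weak_conv_imp_integral_bdd_continuous_conv[rotated 2])
    show "real_distribution (distr (?PM d) borel (W d))" for d
      using PM by (rule prob_space.real_distribution_distr) (rule W)
    show "norm (min 1 (exp (- (\<sigma> * w + \<sigma>\<^sup>2/2)))) \<le> 1" for w by (auto simp: min_def)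
  qed (auto intro!: real_dist_normal_dist continuous_intros)
  moreover have "(LINT w|distr (?PM d) borel (W d). min 1 (exp (- (\<sigma> * w + \<sigma>\<^sup>2/2))))
      = (LINT X|?PM d. min 1 (exp (- (\<Sum>i<d. \<Delta> (X i) (h d)))))" for d
  proof -
    have "\<sigma> * W d X + \<sigma>\<^sup>2/2 = (\<Sum>i<d. \<Delta> (X i) (h d))" for X
      using \<sigma> by (simp add: W_def)
    then show ?thesis by (subst integral_distr) auto
  qed
  ultimately show ?thesis
    unfolding expectation_min_1_exp_normal[OF \<sigma>] by (simp add: h_def \<sigma>_def S_def)
qed

end

section \<open>Cost and optimal acceptance\<close>

text \<open>After scaling, rounding up and the overheads each contribute only order d^(-1/4), so
  just the leapfrog steps survive in the limit.\<close>

lemma proposal_cost_tendsto: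
  assumes "0 < l" "0 < T"
  shows "(\<lambda>d. real d powr (-5/4) * proposal_cost T C_LF C_O l d) \<longlonglongrightarrow> T * C_LF / l"
proof -
  define x where "x d = real d powr (1/4)" for d :: nat
  have "(\<lambda>d. real d powr (-(1/4))) \<longlonglongrightarrow> 0"
    by (rule tendsto_neg_powr) (auto simp: filterlim_real_sequentially)
  then have inv: "(\<lambda>d. inverse (x d)) \<longlonglongrightarrow> 0"
    unfolding x_def powr_minus .
  have x_pos: "\<forall>\<^sub>F d in sequentially. 0 < x d"
    using eventually_gt_at_top[of 0] by eventually_elim (simp add: x_def)
  have "(\<lambda>d. of_int \<lceil>T * x d / l\<rceil> * inverse (x d)) \<longlonglongrightarrow> T / l"
  proof (rule tendsto_sandwich)
    show "\<forall>\<^sub>F d in sequentially. T / l \<le> of_int \<lceil>T * x d / l\<rceil> * inverse (x d)"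
      using x_pos
    proof eventually_elim
      case (elim d)
      have "T / l = (T * x d / l) * inverse (x d)" using elim by simp
      also have "\<dots> \<le> of_int \<lceil>T * x d / l\<rceil> * inverse (x d)"
        using elim by (intro mult_right_mono le_of_int_ceiling) simp
      finally show ?case .
    qed
    show "\<forall>\<^sub>F d in sequentially. of_int \<lceil>T * x d / l\<rceil> * inverse (x d) \<le> T / l + inverse (x d)"
      using x_pos
    proof eventually_elim
      case (elim d)
      have "of_int \<lceil>T * x d / l\<rceil> * inverse (x d) \<le> (T * x d / l + 1) * inverse (x d)"
        using elim by (intro mult_right_mono of_int_ceiling_le_add_one) simp
      also have "\<dots> = T / l + inverse (x d)" using elim by (simp add: field_simps)
      finally show ?case .
    qed
    show "(\<lambda>d. T / l + inverse (x d)) \<longlonglongrightarrow> T / l"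
      using tendsto_add[OF tendsto_const inv, of "T / l"] by simp
  qed simp
  then have "(\<lambda>d. of_int \<lceil>T * x d / l\<rceil> * inverse (x d) * C_LF + inverse (x d) * C_O) \<longlonglongrightarrow> T / l * C_LF + 0 * C_O"
    by (intro tendsto_add tendsto_mult tendsto_const inv)
  then have "(\<lambda>d. of_int \<lceil>T * x d / l\<rceil> * inverse (x d) * C_LF + inverse (x d) * C_O) \<longlonglongrightarrow> T * C_LF / l"
    by simp
  moreover have "\<forall>\<^sub>F d in sequentially. of_int \<lceil>T * x d / l\<rceil> * inverse (x d) * C_LF + inverse (x d) * C_O
      = real d powr (-5/4) * proposal_cost T C_LF C_O l d"
    using eventually_gt_at_top[of 0]
  proof eventually_elim
    case (elim d)
    have "real d powr (-5/4) * real d = real d powr (-5/4) * real d powr 1" using elim by simp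
    also have "\<dots> = real d powr (-(1/4))" by (subst powr_add[symmetric]) simp
    also have "\<dots> = inverse (x d)" by (simp add: x_def powr_minus)
    finally have *: "inverse (x d) = real d powr (-5/4) * real d" ..
    show ?case unfolding * proposal_cost_def x_def[symmetric] by (simp only: distrib_left ac_simps)
  qed
  ultimately show ?thesis by (rule Lim_transform_eventually)
qed

theorem theorem4p1:
  fixes M :: "real ^ 'm ^ 'm" and V :: "real ^ 'm \<Rightarrow> real"
    and T C_LF C_O S :: real
    and \<alpha> D :: "'m phase \<Rightarrow> real"
    and \<rho> :: "'m phase \<Rightarrow> real \<Rightarrow> real"
  assumes "symmetric_pos_def M"
    and "0 < T" and "0 < C_LF" and "0 \<le> C_O"
    and "\<And>q. V differentiable (at q)"
    and "integrable lborel (\<lambda>q. exp (- V q))"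
    and "\<And>x h. 0 < h \<Longrightarrow> energy_error M V T x h = h\<^sup>2 * \<alpha> x + h\<^sup>2 * \<rho> x h"
    and "\<And>x. ((\<lambda>h. \<rho> x h) \<longlongrightarrow> 0) (at_right 0)"
    and "\<And>x. (SUP h\<in>{0<..1}. ereal (\<bar>energy_error M V T x h\<bar>\<^sup>2 / h ^ 4)) \<le> ereal (D x)"
    and "integrable lebesgue (\<lambda>x. D x * exp (- hamiltonian M V x))"
    and "S = (LINT x|target M V. (\<alpha> x)\<^sup>2)"
    and "0 < S"
  shows "(\<forall>l>0. (\<lambda>d. mean_acceptance M V T l d) \<longlonglongrightarrow> 2 * Phi (- l\<^sup>2 * sqrt S / 2))
    \<and> (\<forall>l>0. convergent (\<lambda>d. real d powr (-5/4) * expected_cost M V T C_LF C_O l d))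
    \<and> (\<exists>a_opt l_opt.
          (\<forall>S'>0. \<forall>a. is_arg_max (eff S') (\<lambda>a. a \<in> {0<..<1}) a \<longleftrightarrow> a = a_opt)
        \<and> (\<forall>l. 0 < l \<and> limit_acceptance M V T l = a_opt \<longleftrightarrow> l = l_opt)
        \<and> is_arg_min (asymptotic_cost M V T C_LF C_O) (\<lambda>l. 0 < l) l_opt
        \<and> round (1000 * a_opt) = 651)"
proof -
  let ?H = "hamiltonian M V" and ?\<Delta> = "energy_error M V T" and ?P = "target M V"
  define Z where "Z = (LINT x|lborel. exp (- ?H x))"
  note V = assms(5)
  note [measurable] = borel_measurable_hamiltonian[OF V] borel_measurable_energy_error[OF V]
  have target: "?P = density lborel (\<lambda>x. ennreal (exp (- ?H x) / Z))"
    by (simp add: target_def Z_def)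
  have sets_P [measurable_cong]: "sets ?P = sets borel" by (simp add: target)
  have lim: "((\<lambda>h. ?\<Delta> x h / h\<^sup>2) \<longlongrightarrow> \<alpha> x) (at_right 0)" for x
  proof (rule Lim_transform_eventually)
    show "((\<lambda>h. \<alpha> x + \<rho> x h) \<longlongrightarrow> \<alpha> x) (at_right 0)"
      using tendsto_add[OF tendsto_const assms(8), of "\<alpha> x" x] by simp
    show "\<forall>\<^sub>F h in at_right 0. \<alpha> x + \<rho> x h = ?\<Delta> x h / h\<^sup>2"
      using eventually_at_right_less[of 0]
      by eventually_elim (simp add: assms(7) add_divide_distrib)
  qed
  have \<alpha> [measurable]: "\<alpha> \<in> borel_measurable borel"
  proof (rule borel_measurable_LIMSEQ_real)
    have "filterlim (\<lambda>n. inverse (real (Suc n))) (at_right 0) sequentially"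
      using LIMSEQ_inverse_real_of_nat by (auto simp: filterlim_at)
    then show "(\<lambda>n. ?\<Delta> x (inverse (real (Suc n))) / (inverse (real (Suc n)))\<^sup>2) \<longlonglongrightarrow> \<alpha> x" for x
      by (rule filterlim_compose[OF lim])
  qed measurable
  \<comment> \<open>If \<open>exp (- H)\<close> were not integrable, \<open>Z\<close> would be \<open>0\<close>, so \<open>target\<close> would be the null measure
    (\<open>x / 0 = 0\<close>) and \<open>S\<close> would vanish.\<close>
  have "Z \<noteq> 0"
  proof
    assume "Z = 0"
    then have "S = 0" using integral_target[OF V, of "\<lambda>x. (\<alpha> x)\<^sup>2"] by (simp add: assms(11) Z_def)
    with assms(12) show False by simp
  qed
  moreover have "0 \<le> Z" by (simp add: Z_def)
  ultimately have Z: "0 < Z" by simp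
  have int_H: "integrable lborel (\<lambda>x. exp (- ?H x))"
    using \<open>Z \<noteq> 0\<close> not_integrable_integral_eq unfolding Z_def by blast
  interpret P: prob_space ?P
  proof (rule prob_spaceI)
    have "emeasure ?P (space ?P) = (\<integral>\<^sup>+x. ennreal (exp (- ?H x) / Z) \<partial>lborel)"
      by (simp add: target emeasure_density)
    also have "\<dots> = ennreal (LINT x|lborel. exp (- ?H x) / Z)"
      using Z int_H by (intro nn_integral_eq_integral) auto
    also have "\<dots> = 1" using Z by (simp add: Z_def[symmetric])
    finally show "emeasure ?P (space ?P) = 1" .
  qed
  \<comment> \<open>\<open>D\<close> is only Lebesgue measurable, while \<open>target\<close> is a measure on the Borel sets.\<close>
  obtain g where g [measurable]: "g \<in> borel_measurable lborel"
    and g_AE: "AE x in lborel. D x * exp (- ?H x) = g x"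
    using completion_ex_borel_measurable_real[OF borel_measurable_integrable[OF assms(10)]] by blast
  have "integrable lebesgue g"
    using assms(10) g g_AE
    by (subst integrable_cong_AE[where g="\<lambda>x. D x * exp (- ?H x)"])
      (auto intro: measurable_completion AE_completion simp: eq_commute)
  then have int_g: "integrable lborel g" by (simp add: integrable_completion)
  \<comment> \<open>Dividing out the positive weight turns g into a Borel version of D.\<close>
  define D' where "D' x = g x * exp (?H x)" for x
  have D'_AE: "AE x in ?P. D x = D' x"
    unfolding target
  proof (subst AE_density)
    show "AE x in lborel. 0 < ennreal (exp (- ?H x) / Z) \<longrightarrow> D x = D' x"
      using g_AE
    proof eventually_elim
      case (elim x)
      have "D' x = D x * (exp (- ?H x) * exp (?H x))" unfolding D'_def elim[symmetric] by simp
      then show ?case by (simp add: exp_minus)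
    qed
  qed measurable
  have int_D': "integrable ?P D'"
  proof -
    have eq: "exp (- ?H x) / Z * D' x = g x / Z" for x
      by (simp add: D'_def exp_minus)
    have [measurable]: "D' \<in> borel_measurable borel" unfolding D'_def[abs_def] by measurable
    have "integrable lborel (\<lambda>x. (exp (- ?H x) / Z) *\<^sub>R D' x)"
      unfolding real_scaleR_def eq using int_g by simp
    then show ?thesis
      unfolding target using Z by (subst integrable_density) auto
  qed
  have bound: "(?\<Delta> x h)\<^sup>2 \<le> h^4 * D x" if "0 < h" "h \<le> 1" for x h
  proof -
    have "ereal (\<bar>?\<Delta> x h\<bar>\<^sup>2 / h ^ 4) \<le> ereal (D x)"
      using that by (intro order_trans[OF SUP_upper assms(9)]) auto
    then show ?thesis using that by (simp add: divide_le_eq mult.commute)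
  qed
  have balance: "P.expectation (\<lambda>x. sin (t * ?\<Delta> x h)) = P.expectation (\<lambda>x. sin (t * ?\<Delta> x h) * tanh_half (?\<Delta> x h))" for t h
  proof -
    \<comment> \<open>This weight makes \<open>f\<close> satisfy \<open>f (- y) * exp (- y) = - f y\<close>, so time reversal forces its mean to be \<open>0\<close>.\<close>
    define f where "f y = sin (t * y) / (1 + exp y)" for y
    have [measurable]: "f \<in> borel_measurable borel" unfolding f_def by measurable
    have pos: "0 < 1 + exp y" for y :: real by (simp add: add_pos_pos)
    have odd: "f (- y) * exp (- y) = - f y" for y
    proof -
      have "1 + exp (- y) = (1 + exp y) * exp (- y)" by (simp add: algebra_simps flip: exp_add)
      then show ?thesis by (simp add: f_def)
    qed
    have "P.expectation (\<lambda>x. f (?\<Delta> x h)) = P.expectation (\<lambda>x. - f (?\<Delta> x h))"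
      using integral_target_reverse[OF V, of f M T h] by (simp add: odd)
    then have zero: "P.expectation (\<lambda>x. f (?\<Delta> x h)) = 0" by simp
    \<comment> \<open>Since f(\<Delta>) has mean 0, subtracting 2 f leaves the expectation of the
      sine unchanged.\<close>
    have sin_eq: "sin (t * y) * tanh_half y = sin (t * y) - 2 * f y" for y
      using pos[of y] by (simp add: f_def tanh_half_def field_simps)
    have f_le: "\<bar>f y\<bar> \<le> 1" for y
    proof -
      have "\<bar>sin (t * y)\<bar> \<le> 1 + exp y"
        using abs_sin_le_one[of "t * y"] exp_gt_zero[of y] by linarith
      then show ?thesis using pos[of y] by (simp add: f_def abs_divide abs_of_pos[OF pos])
    qed
    have "integrable ?P (\<lambda>x. sin (t * ?\<Delta> x h))" "integrable ?P (\<lambda>x. f (?\<Delta> x h))"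
      by (auto intro!: P.integrable_const_bound[where B=1] simp: f_le)
    then show ?thesis by (simp add: sin_eq zero)
  qed
  interpret balanced_error ?P ?\<Delta> \<alpha> D'
  proof
    show "AE x in ?P. \<forall>h. 0 < h \<longrightarrow> h \<le> 1 \<longrightarrow> (?\<Delta> x h)\<^sup>2 \<le> h^4 * D' x"
      using D'_AE
    proof eventually_elim
      case (elim x)
      show ?case unfolding elim[symmetric] using bound by blast
    qed
  qed (use lim int_D' balance assms(11,12) in \<open>auto simp: measurable_cong_sets[OF sets_P refl]\<close>)
  have mean: "(\<lambda>d. mean_acceptance M V T l d) \<longlonglongrightarrow> 2 * Phi (- l\<^sup>2 * sqrt S / 2)" if "0 < l" for l
  proof -
    have "acceptance M V d X (proposal M V T h d X) = min 1 (exp (- (\<Sum>i<d. ?\<Delta> (X i) h)))" for d X h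
      by (simp add: acceptance_def proposal_def energy_error_def sum_negf[symmetric])
    then show ?thesis
      using mean_acceptance_tendsto[OF that] by (simp add: mean_acceptance_def assms(11))
  qed
  define A where "A l = 2 * (1 - Phi (l\<^sup>2 * sqrt S / 2))" for l
  have A_eq: "2 * Phi (- l\<^sup>2 * sqrt S / 2) = A l" for l
    using Phi_minus[of "l\<^sup>2 * sqrt S / 2"] by (simp add: A_def)
  have A_pos: "0 < A l" for l using Phi_less_1 by (simp add: A_def)
  have limit: "limit_acceptance M V T l = A l" if "0 < l" for l
    unfolding limit_acceptance_def using mean[OF that] A_eq by (simp add: limI)
  have cost: "(\<lambda>d. real d powr (-5/4) * expected_cost M V T C_LF C_O l d) \<longlonglongrightarrow> T * C_LF / l / A l" if "0 < l" for l
  proof -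
    have "A l \<noteq> 0" using A_pos[of l] by simp
    then show ?thesis
      unfolding expected_cost_def times_divide_eq_right
      by (intro tendsto_divide proposal_cost_tendsto that assms(2) mean[OF that, unfolded A_eq])
  qed
  obtain z where z: "0.4518 \<le> z" "z \<le> 0.4525" "\<And>y. 0 < y \<Longrightarrow> y < z \<Longrightarrow> 0 < crit y"
      "\<And>y. z < y \<Longrightarrow> crit y < 0"
    by (rule crit_sign_change) blast
  have z_pos: "0 < z" using z(1) by simp
  \<comment> \<open>The value a depends on z alone and hence not on the target. The step parameter
    \<open>l\<^sub>0\<close> below is the positive solution of l^2 sqrt S / 2 = z, which makes its
    limit acceptance equal to a.\<close>
  define a where "a = 2 * (1 - Phi z)"
  define l\<^sub>0 where "l\<^sub>0 = sqrt (2 * z / sqrt S)"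
  have l\<^sub>0_pos: "0 < l\<^sub>0" using z_pos assms(12) by (simp add: l\<^sub>0_def)
  have l\<^sub>0: "l\<^sub>0\<^sup>2 * sqrt S / 2 = z" using z_pos assms(12) by (simp add: l\<^sub>0_def)
  have "l * A l \<le> l\<^sub>0 * A l\<^sub>0" if "0 < l" for l
  proof -
    \<comment> \<open>With y = r^2 sqrt S / 2 one has sqrt y = c r, so c rescales r * A r to twice
      the unimodal function of y.\<close>
    define c where "c = sqrt (sqrt S / 2)"
    have c: "0 < c" using assms(12) by (simp add: c_def)
    have eq: "c * (r * A r) = 2 * (sqrt (r\<^sup>2 * sqrt S / 2) * (1 - Phi (r\<^sup>2 * sqrt S / 2)))" if "0 < r" for r
    proof -
      have "r\<^sup>2 * sqrt S / 2 = r\<^sup>2 * (sqrt S / 2)" by simp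
      then have "sqrt (r\<^sup>2 * sqrt S / 2) = r * c"
        using that by (simp only: real_sqrt_mult c_def real_sqrt_abs abs_of_pos)
      then show ?thesis by (simp add: A_def)
    qed
    have "0 < l\<^sup>2 * sqrt S / 2" using that assms(12) by simp
    then have "sqrt (l\<^sup>2 * sqrt S / 2) * (1 - Phi (l\<^sup>2 * sqrt S / 2)) \<le> sqrt z * (1 - Phi z)"
      using sqrt_mult_tail_unimodal[OF z_pos z(3,4), of "l\<^sup>2 * sqrt S / 2"]
      by (cases "l\<^sup>2 * sqrt S / 2 = z") (auto intro: less_imp_le)
    then have "c * (l * A l) \<le> c * (l\<^sub>0 * A l\<^sub>0)"
      using eq[OF that] eq[OF l\<^sub>0_pos] l\<^sub>0 by simp
    then show ?thesis using c by simp
  qed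
  then have min: "T * C_LF / l\<^sub>0 / A l\<^sub>0 \<le> T * C_LF / l / A l" if "0 < l" for l
    unfolding divide_divide_eq_left using that A_pos[of l] A_pos[of "l\<^sub>0"] l\<^sub>0_pos assms(2,3)
    by (intro divide_left_mono) auto
  have asymp: "asymptotic_cost M V T C_LF C_O l = T * C_LF / l / A l" if "0 < l" for l
    unfolding asymptotic_cost_def using cost[OF that] by (rule limI)
  have "is_arg_min (asymptotic_cost M V T C_LF C_O) (\<lambda>l. 0 < l) l\<^sub>0"
    unfolding is_arg_min_def
  proof (intro conjI notI)
    assume "\<exists>l>0. asymptotic_cost M V T C_LF C_O l < asymptotic_cost M V T C_LF C_O l\<^sub>0"
    then obtain l where "0 < l" "asymptotic_cost M V T C_LF C_O l < asymptotic_cost M V T C_LF C_O l\<^sub>0"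
      by blast
    then show False using min[of l] asymp[of l] asymp[OF l\<^sub>0_pos] by linarith
  qed (rule l\<^sub>0_pos)
  moreover have "\<forall>l. 0 < l \<and> limit_acceptance M V T l = a \<longleftrightarrow> l = l\<^sub>0"
  proof (intro allI iffI conjI)
    fix l assume l: "0 < l \<and> limit_acceptance M V T l = a"
    then have "Phi (l\<^sup>2 * sqrt S / 2) = Phi z" using limit[of l] by (simp add: A_def a_def)
    then have "l\<^sup>2 * sqrt S / 2 = l\<^sub>0\<^sup>2 * sqrt S / 2" using strict_mono_eq[OF Phi_strict_mono] l\<^sub>0 by simp
    then have "l\<^sup>2 = l\<^sub>0\<^sup>2" using assms(12) by simp
    then show "l = l\<^sub>0" using l l\<^sub>0_pos by (simp add: power2_eq_iff_nonneg)
  qed (use l\<^sub>0_pos limit[OF l\<^sub>0_pos] l\<^sub>0 in \<open>auto simp: A_def a_def\<close>)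
  moreover have "\<forall>S'>0. \<forall>b. is_arg_max (eff S') (\<lambda>a. a \<in> {0<..<1}) b \<longleftrightarrow> b = a"
    unfolding a_def using is_arg_max_eff_iff z_pos z(3,4) by blast
  moreover have "round (1000 * a) = 651"
    using acceptance_bounds[OF z(1,2)] by (intro round_unique) (simp_all add: a_def)
  moreover have "\<forall>l>0. convergent (\<lambda>d. real d powr (-5/4) * expected_cost M V T C_LF C_O l d)"
    using cost convergentI by blast
  ultimately show ?thesis using mean by blast
qed

end
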